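(* Let $\lambda>\frac1e$ be real and $E_\lambda(z)=\lambda e^z$. Let $t_0,t_1,\ldots$ be a sequence of finite blocks (finite sequences) of integers such that for every $m\in\mathbb{N}$ at least one term of the block $t_m$ is non-zero. Then there exists a sequence of natural numbers $(n_q)_{q\in\mathbb{N}}$ such that, if $s$ is the infinite sequence obtained by concatenation $$s=0_{n_0}t_00_{n_1}t_10_{n_2}t_2\ldots,$$ then there exists exactly one point $z_s\in I_s$ such that (i) the $\omega$-limit set of $z_s$ contains at least one of the points $q_+$, $q_-$; and (ii) if $z\in I_s\setminus(\gamma_s\cup\{z_s\})$, then the $\omega$-limit set of $z$ is equal to $\operatorname{Orb}(0)\cup\{\infty\}$. Every other point of $I_s$ lies on the curve $\gamma_s$, and the $\omega$-limit set of such a point is $\{\infty\}$.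
   Context: $\mathbb{N}=\{0,1,2,\ldots\}$. $0_k$ denotes the block consisting of $k$ zeros, $k\in\mathbb{N}$. For $j\in\mathbb{Z}$ let $R_j=\{z\in\mathbb{C}:(2j-1)\pi<\operatorname{Im}(z)\le(2j+1)\pi\}$. For $s=(s_0s_1\ldots)\in\mathbb{Z}^{\mathbb{N}}$ let $I_s=\{z\in\mathbb{C}: E_\lambda^j(z)\in R_{s_j}\text{ for all } j\in\mathbb{N}\}$, where $E_\lambda^j$ is the $j$-th iterate. A sequence $s$ is exponentially bounded if there are $A,x>0$ with $|s_k|<AF^k(x)$ for all $k\in\mathbb{N}$, where $F(t)=e^t-1$ and $F^k$ is its $k$-th iterate. For an exponentially bounded $s$ that does not end with an infinite sequence of zeros, let $\Gamma_s=\{z\in I_s:E_\lambda^n(z)\to\infty\text{ as } n\to\infty\}$. It is known (Schleicher--Zimmer) that $\Gamma_s$ is the image of an injective continuous curve $\psi:(0,+\infty)\to\mathbb{C}$ or $\psi:[0,+\infty)\to\mathbb{C}$ with $\lim_{\eta\to+\infty}\psi(\eta)=\infty$. In both cases the hair associated with $s$ is $\gamma_s=\psi|_{(0,+\infty)}$; the symbol $\gamma_s$ also denotes its image. An assertion about $\gamma_s$ includes the assertion that $s$ is exponentially bounded, so that $\gamma_s$ is defined. For $\lambda>\frac1e$ the map $E_\lambda$ has two repelling fixed points in $R_0$: $q_+$, with positive imaginary part, and $q_-$, with negative imaginary part. $\operatorname{Orb}(0)=\{0,E_\lambda(0),E_\lambda^2(0),\ldots\}$. The $\omega$-limit set of $z$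 is the set of all limits in $\widehat{\mathbb{C}}=\mathbb{C}\cup\{\infty\}$ of sequences $E_\lambda^{m_k}(z)$ with $m_k\to\infty$. *)

theory Defs
  imports "HOL-Analysis.Analysis" "HOL-Library.Stream"
begin

definition E :: "real \<Rightarrow> complex \<Rightarrow> complex" where
  "E lam z = of_real lam * exp z"

definition strip :: "int \<Rightarrow> complex set" where
  "strip j = {z. (2 * of_int j - 1) * pi < Im z \<and> Im z \<le> (2 * of_int j + 1) * pi}"

definition itinerary_set :: "real \<Rightarrow> (nat \<Rightarrow> int) \<Rightarrow> complex set" where
  "itinerary_set lam s = {z. \<forall>j. (E lam ^^ j) z \<in> strip (s j)}"

definition exponentially_bounded :: "(nat \<Rightarrow> int) \<Rightarrow> bool" where
  "exponentially_bounded s \<longleftrightarrow>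
     (\<exists>A>0. \<exists>x>0. \<forall>k. real_of_int \<bar>s k\<bar> < A * ((\<lambda>t::real. exp t - 1) ^^ k) x)"

definition escaping_set :: "real \<Rightarrow> (nat \<Rightarrow> int) \<Rightarrow> complex set" where
  "escaping_set lam s =
     {z \<in> itinerary_set lam s. filterlim (\<lambda>n. (E lam ^^ n) z) at_infinity sequentially}"

definition hair_parametrization :: "real \<Rightarrow> (nat \<Rightarrow> int) \<Rightarrow> (real \<Rightarrow> complex) \<Rightarrow> bool" where
  "hair_parametrization lam s \<psi> \<longleftrightarrow>
     (\<exists>D\<in>{{0<..}, {0..}}. continuous_on D \<psi> \<and> inj_on \<psi> D \<and> \<psi> ` D = escaping_set lam s) \<and>
     filterlim \<psi> at_infinity at_top"

text \<open>
  The hair as a set. For exponentially bounded \<open>s\<close> not ending in zeros a parametrization exists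
  (Schleicher and Zimmer). The choice of \<open>\<psi>\<close> does not matter: a closed ray is not the image of an
  open one under a continuous injection tending to infinity, and in the closed case the endpoint
  \<open>\<psi> 0\<close>, which is not part of the hair, is determined by the escaping set. The value is
  unspecified if no parametrization exists.
\<close>
definition hair :: "real \<Rightarrow> (nat \<Rightarrow> int) \<Rightarrow> complex set" where
  "hair lam s = (SOME \<psi>. hair_parametrization lam s \<psi>) ` {0<..}"

definition repelling_fixed_point :: "(complex \<Rightarrow> complex) \<Rightarrow> complex \<Rightarrow> bool" where
  "repelling_fixed_point f z \<longleftrightarrow> f z = z \<and> norm (deriv f z) > 1"

text \<open>
  For \<open>lam > 1/e\<close> each of the following two points is well defined: writing \<open>z = x + \<i>y\<close>, the
  fixed point equation with \<open>0 < \<bar>y\<bar> < pi\<close> says \<open>x = y cot y\<close> and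
  \<open>lam = (y / sin y) exp (- y cot y)\<close>, whose right-hand side increases from \<open>1/e\<close> to infinity
  in \<open>\<bar>y\<bar>\<close>.
\<close>
definition q_plus :: "real \<Rightarrow> complex" where
  "q_plus lam = (THE z. z \<in> strip 0 \<and> repelling_fixed_point (E lam) z \<and> Im z > 0)"

definition q_minus :: "real \<Rightarrow> complex" where
  "q_minus lam = (THE z. z \<in> strip 0 \<and> repelling_fixed_point (E lam) z \<and> Im z < 0)"

definition Orb0 :: "real \<Rightarrow> complex set" where
  "Orb0 lam = range (\<lambda>n. (E lam ^^ n) 0)"

text \<open>
  The Riemann sphere is the one-point compactification of the complex plane, with \<open>None\<close> in the
  role of infinity and \<open>Some z\<close> in that of the finite point \<open>z\<close>.
\<close>
definition omega_limit :: "real \<Rightarrow> complex \<Rightarrow> complex option set" where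
  "omega_limit lam z =
     {w. \<exists>m. filterlim m at_top sequentially \<and>
        limitin (Alexandroff_compactification euclidean) (\<lambda>k. Some ((E lam ^^ m k) z)) w sequentially}"

text \<open>
  The sequence \<open>0\<^bsub>n 0\<^esub> (t 0) 0\<^bsub>n 1\<^esub> (t 1) \<dots>\<close>. It is the intended concatenation only if every
  list \<open>replicate (n q) 0 @ t q\<close> is non-empty, as \<open>flat\<close> requires.
\<close>
definition block_sequence :: "(nat \<Rightarrow> nat) \<Rightarrow> (nat \<Rightarrow> int list) \<Rightarrow> nat \<Rightarrow> int" where
  "block_sequence n t = snth (flat (smap (\<lambda>q. replicate (n q) 0 @ t q) nats))"

end

theory Submission
  imports Defs "HOL-Complex_Analysis.Complex_Analysis" "HOL-Real_Asymp.Real_Asymp"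
begin

text \<open>
  Inside a block of zeros an orbit stays in one half plane, where the inverse branch \<open>L\<close> of \<open>E lam\<close>
  contracts to \<open>q_plus\<close> or \<open>q_minus\<close> by the Schwarz lemma. Let \<open>b p\<close> be the position of the first
  non-zero entry of \<open>t p\<close>. If the point at time \<open>b (p + 1)\<close> lies in a compact set off the real axis and the
  zero block is long, then \<open>L\<close> takes it close to a fixed point, and the finitely many branches of
  \<open>t p\<close> then take it to a compact set that depends on \<open>t p\<close> only. Hence being in these compact sets at the
  times \<open>b p\<close> is inherited downwards in \<open>p\<close>, and exactly one point \<open>z_s\<close> is in all of them. Every other orbit
  eventually leaves every compact set off the real axis, so its finite limit points are real; pulling
  a non-zero limit point \<open>x\<close> back gives the limit point \<open>ln (x / lam)\<close>, and this descent can end only at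
  \<open>0\<close>, so the limit set is empty in the plane or contains exactly the orbit of \<open>0\<close>.

  Long zero blocks also make \<open>s\<close> grow so slowly that the escaping points of \<open>I_s\<close> are those that stay at
  linear distance from an orbit of \<open>F(t) = exp t - 1\<close> with \<open>t > 0\<close>, one for each \<open>t\<close>; this parametrizes the hair.
\<close>

section \<open>Inverse branches\<close>

text \<open>The delicate point is the order of choices: the compact set at time \<open>b p\<close>
  must not depend on the lengths of later zero blocks, or these could not be chosen one after the
  other. Two facts break the circle. Whatever compact set is prescribed at time
  \<open>b (p + 1)\<close>, a long enough zero block leads from it into the fixed set
  \<open>offaxis c_q\<close>; and pulling back along zeros stays in one compact set for all block
  lengths at once. So \<open>c p\<close> depends on \<open>p\<close> and \<open>t p\<close> alone,
  and \<open>n p\<close> is then chosen knowing \<open>c p\<close> and the finite word before it.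

  The non-zero entry at \<open>b p\<close> has a second use: its sign decides the half plane and
  hence which fixed point attracts. Two points with itinerary \<open>s\<close> are drawn to the same
  one, and uniqueness of \<open>z_s\<close> then rests on continuity of a finite pullback
  there.\<close>

definition branch :: "real \<Rightarrow> int \<Rightarrow> complex \<Rightarrow> complex" where
  "branch lam j w = Ln (w / of_real lam) + of_real (2 * pi * of_int j) * \<i>"

definition pull :: "real \<Rightarrow> int list \<Rightarrow> complex \<Rightarrow> complex" where
  "pull lam xs = foldr (branch lam) xs"

text \<open>The sets \<open>offaxis c\<close> are compact, avoid the real axis and exhaust its complement.\<close>
definition offaxis :: "real \<Rightarrow> complex set" where
  "offaxis c = {z. norm z \<le> c \<and> 1 \<le> c * \<bar>Im z\<bar>}"

lemma pull_simps [simp]: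
  "pull lam [] w = w"
  "pull lam (x # xs) w = branch lam x (pull lam xs w)"
  "pull lam (xs @ ys) w = pull lam xs (pull lam ys w)"
  by (simp_all add: pull_def)

lemma pull_replicate: "pull lam (replicate n x) w = (branch lam x ^^ n) w"
  by (induction n) auto

lemma offaxis_ge_1: "z \<in> offaxis c \<Longrightarrow> 1 \<le> c"
proof (rule ccontr)
  assume z: "z \<in> offaxis c" and "\<not> 1 \<le> c"
  have "0 \<le> c" "\<bar>Im z\<bar> \<le> c"
    using z norm_ge_zero[of z] abs_Im_le_cmod[of z] unfolding offaxis_def mem_Collect_eq by linarith+
  then have "c * \<bar>Im z\<bar> \<le> c * c" by (simp add: mult_left_mono)
  moreover have "c * c < 1" using \<open>0 \<le> c\<close> \<open>\<not> 1 \<le> c\<close> mult_strict_mono[of c 1 c 1] by simp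
  ultimately show False using z by (simp add: offaxis_def)
qed

lemma offaxis_Im_nonzero: "z \<in> offaxis c \<Longrightarrow> Im z \<noteq> 0"
  by (auto simp: offaxis_def)

lemma offaxis_mono: "c \<le> c' \<Longrightarrow> offaxis c \<subseteq> offaxis c'"
proof
  fix z assume "c \<le> c'" and z: "z \<in> offaxis c"
  have "c * \<bar>Im z\<bar> \<le> c' * \<bar>Im z\<bar>" using \<open>c \<le> c'\<close> by (simp add: mult_right_mono)
  then show "z \<in> offaxis c'" using z \<open>c \<le> c'\<close> by (auto simp: offaxis_def)
qed

lemma in_offaxisI:
  assumes "norm z \<le> c" "e \<le> \<bar>Im z\<bar>" "1 \<le> c * e" 
  shows "z \<in> offaxis c"
proof -
  have "0 \<le> c" using norm_ge_zero assms(1) by (rule order_trans)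
  then have "c * e \<le> c * \<bar>Im z\<bar>" using assms(2) by (simp add: mult_left_mono)
  with assms show ?thesis by (simp add: offaxis_def)
qed

lemma compact_offaxis: "compact (offaxis c)"
proof -
  have "closed (offaxis c)" unfolding offaxis_def
    by (intro closed_Collect_conj closed_Collect_le continuous_intros)
  moreover have "bounded (offaxis c)"
    by (rule boundedI[of _ c]) (auto simp: offaxis_def)
  ultimately show ?thesis by (simp add: compact_eq_bounded_closed)
qed

lemma sgn_of_strip_pos: "z \<in> strip j \<Longrightarrow> j > 0 \<Longrightarrow> Im z > 0"
proof -
  assume "z \<in> strip j" "j > 0"
  then have "(2 * real_of_int j - 1) * pi < Im z" "real_of_int j \<ge> 1" by (auto simp: strip_def)
  moreover from this have "0 \<le> (2 * real_of_int j - 1) * pi" by simp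
  ultimately show "Im z > 0" by linarith
qed

lemma sgn_of_strip_neg: "z \<in> strip j \<Longrightarrow> j < 0 \<Longrightarrow> Im z < 0"
proof -
  assume "z \<in> strip j" "j < 0"
  then have a: "Im z \<le> (2 * real_of_int j + 1) * pi" and "real_of_int j \<le> -1" by (auto simp: strip_def)
  then have "(2 * real_of_int j + 1) * pi < 0" by (simp add: mult_neg_pos)
  with a show "Im z < 0" by linarith
qed

lemma strip_Im_nonzero: "z \<in> strip j \<Longrightarrow> j \<noteq> 0 \<Longrightarrow> Im z \<noteq> 0"
  using sgn_of_strip_pos sgn_of_strip_neg by (metis less_irrefl linorder_neqE_linordered_idom)

lemma abs_Im_strip: "z \<in> strip j \<Longrightarrow> \<bar>Im z\<bar> \<le> (2 * \<bar>real_of_int j\<bar> + 1) * pi"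
proof -
  assume "z \<in> strip j"
  then have "(2 * real_of_int j - 1) * pi < Im z" "Im z \<le> (2 * real_of_int j + 1) * pi"
    by (auto simp: strip_def)
  moreover have "(2 * real_of_int j + 1) * pi \<le> (2 * \<bar>real_of_int j\<bar> + 1) * pi"
    "- ((2 * \<bar>real_of_int j\<bar> + 1) * pi) \<le> (2 * real_of_int j - 1) * pi"
    using mult_right_mono[of "2 * real_of_int j + 1" "2 * \<bar>real_of_int j\<bar> + 1" pi]
      mult_right_mono[of "- (2 * \<bar>real_of_int j\<bar> + 1)" "2 * real_of_int j - 1" pi]
    unfolding mult_minus_left by auto
  ultimately show ?thesis by linarith
qed

lemma exp_int_period: "exp (of_real (2 * pi * of_int j) * \<i>) = (1::complex)"
  by (simp add: exp_eq_1)

locale exp_map =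
  fixes lam :: real
  assumes lam: "lam > 1 / exp 1"
begin

lemma lam_pos: "lam > 0"
  using lam by (smt (verit) divide_pos_pos exp_gt_zero)

lemma ln_lam: "1 + ln lam > 0"
proof -
  have "ln (1 / exp 1) < ln lam" using lam lam_pos by (subst ln_less_cancel_iff) auto
  then show ?thesis by (simp add: ln_div)
qed

lemma E_branch: "w \<noteq> 0 \<Longrightarrow> E lam (branch lam j w) = w"
  using lam_pos by (simp add: E_def branch_def exp_add exp_int_period del: of_real_mult)

lemma norm_E: "norm (E lam z) = lam * exp (Re z)"
  using lam_pos by (simp add: E_def norm_mult)

lemma Re_branch: "w \<noteq> 0 \<Longrightarrow> Re (branch lam j w) = ln (norm w) - ln lam"
  using lam_pos by (simp add: branch_def Re_Ln ln_div norm_divide)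

lemma Im_branch: "Im (branch lam j w) = Im (Ln (w / of_real lam)) + 2 * pi * of_int j"
  by (simp add: branch_def)

lemma branch_in_strip: "w \<noteq> 0 \<Longrightarrow> branch lam j w \<in> strip j"
  using mpi_less_Im_Ln[of "w / of_real lam"] Im_Ln_le_pi[of "w / of_real lam"] lam_pos
  by (auto simp: strip_def Im_branch algebra_simps)

text \<open>The shifted point \<open>z'\<close> has imaginary part above \<open>-pi\<close> and at
  most \<open>pi\<close>, which is the range of \<open>Ln\<close>. The half-open strips match this
  convention, so the upper edge is covered as well.\<close>

lemma branch_E: "z \<in> strip j \<Longrightarrow> branch lam j (E lam z) = z"
proof -
  assume z: "z \<in> strip j"
  define z' where "z' = z - of_real (2 * pi * of_int j) * \<i>"
  have "exp z' = exp z" 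
    by (simp add: z'_def exp_diff exp_int_period del: of_real_mult)
  moreover have "Ln (exp z') = z'"
    using z by (intro Ln_exp) (auto simp: z'_def strip_def algebra_simps)
  ultimately show ?thesis using lam_pos by (simp add: branch_def E_def z'_def)
qed

lemma Im_branch_0_pos: "Im w > 0 \<Longrightarrow> Im (branch lam 0 w) > 0 \<and> Im (branch lam 0 w) < pi"
  using lam_pos Im_Ln_pos_lt_imp[of "w / of_real lam"] by (auto simp: Im_branch)

lemma nonreal_notin_nonpos: "Im w \<noteq> 0 \<Longrightarrow> w / of_real lam \<notin> \<real>\<^sub>\<le>\<^sub>0"
  using lam_pos by (auto simp: complex_nonpos_Reals_iff)

lemma branch_0_cnj: "Im w \<noteq> 0 \<Longrightarrow> branch lam 0 (cnj w) = cnj (branch lam 0 w)"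
  using nonreal_notin_nonpos[of w] by (simp add: branch_def cnj_Ln)

lemma Im_branch_0_neg: "Im w < 0 \<Longrightarrow> Im (branch lam 0 w) < 0 \<and> Im (branch lam 0 w) > - pi"
  using Im_branch_0_pos[of "cnj w"] by (simp add: branch_0_cnj)

lemma branch_Im_nonzero: "Im w \<noteq> 0 \<Longrightarrow> Im (branch lam j w) \<noteq> 0"
proof (cases "j = 0")
  case True
  then show "Im w \<noteq> 0 \<Longrightarrow> Im (branch lam j w) \<noteq> 0" 
    using Im_branch_0_pos[of w] Im_branch_0_neg[of w] by force
next
  case False
  assume "Im w \<noteq> 0"
  then have "w \<noteq> 0" by auto
  from branch_in_strip[OF this] False show "Im (branch lam j w) \<noteq> 0"
    by (rule strip_Im_nonzero)
qed

lemma pull_Im_nonzero: "Im w \<noteq> 0 \<Longrightarrow> Im (pull lam xs w) \<noteq> 0"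
  by (induction xs) (auto simp: branch_Im_nonzero)

lemma isCont_branch: "w / of_real lam \<notin> \<real>\<^sub>\<le>\<^sub>0 \<Longrightarrow> isCont (branch lam j) w"
  unfolding branch_def using lam_pos by (intro continuous_intros) auto

lemma isCont_pull: "Im w \<noteq> 0 \<Longrightarrow> isCont (pull lam xs) w"
proof (induction xs)
  case Nil
  then show ?case by (simp add: pull_def id_def)
next
  case (Cons x xs)
  have "isCont (\<lambda>w. branch lam x (pull lam xs w)) w"
    by (rule isCont_o2[OF Cons.IH[OF Cons.prems]])
      (intro isCont_branch nonreal_notin_nonpos pull_Im_nonzero Cons.prems)
  then show ?case by simp
qed

lemma isCont_E_iter: "isCont (E lam ^^ n) z"
proof (induction n arbitrary: z)
  case 0
  then show ?case by (simp add: id_def)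
next
  case (Suc n)
  have "isCont (\<lambda>z. E lam ((E lam ^^ n) z)) z"
    unfolding E_def[of lam "(E lam ^^ n) _"] by (intro continuous_intros Suc)
  then show ?case by (simp add: o_def)
qed

lemma E_iter_of_real: "(E lam ^^ n) (of_real x) = of_real (((\<lambda>x. lam * exp x) ^^ n) x)"
  by (induction n) (auto simp: E_def exp_of_real)

lemma pull_seg_orbit:
  assumes "i \<le> j" "\<And>k. \<lbrakk>i \<le> k; k < j\<rbrakk> \<Longrightarrow> (E lam ^^ k) z \<in> strip (s k)"
  shows "pull lam (map s [i..<j]) ((E lam ^^ j) z) = (E lam ^^ i) z"
  using assms(1)
proof (induction rule: inc_induct)
  case base
  then show ?case by simp
next
  case (step n)
  have "pull lam (map s [n..<j]) ((E lam ^^ j) z) = branch lam (s n) ((E lam ^^ Suc n) z)"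
    using step by (simp add: upt_conv_Cons)
  then show ?case using step assms(2)[of n] by (simp add: branch_E)
qed

lemma E_iter_pull:
  assumes "Im w \<noteq> 0" 
  shows "i \<le> length xs \<Longrightarrow> (E lam ^^ i) (pull lam xs w) = pull lam (drop i xs) w"
proof (induction i)
  case (Suc i)
  then have "drop i xs = xs ! i # drop (Suc i) xs" by (simp add: Cons_nth_drop_Suc)
  moreover have "pull lam (drop (Suc i) xs) w \<noteq> 0" using pull_Im_nonzero[OF assms] by (metis zero_complex.simps(2))
  ultimately show ?case using Suc by (simp add: E_branch)
qed simp

lemma pull_in_strip:
  assumes "Im w \<noteq> 0" "i < length xs"
  shows "(E lam ^^ i) (pull lam xs w) \<in> strip (xs ! i)"
proof -
  have "drop i xs = xs ! i # drop (Suc i) xs" using assms by (simp add: Cons_nth_drop_Suc)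
  moreover have "pull lam (drop (Suc i) xs) w \<noteq> 0" using pull_Im_nonzero[OF assms(1)] by (metis zero_complex.simps(2))
  ultimately show ?thesis using assms by (simp add: E_iter_pull branch_in_strip)
qed

text \<open>For \<open>j \<noteq> 0\<close> the strip itself is at distance \<open>pi\<close> from
  the real axis. For \<open>j = 0\<close> the relation
  \<open>Im z = norm z * sin (Im (branch lam j z))\<close> shows that the distance shrinks at most
  from \<open>1 / c\<close> to \<open>1 / c\<^sup>2\<close>; hence the square in the new
  constant.\<close>

lemma branch_offaxis:
  assumes "z \<in> offaxis c" "\<bar>j\<bar> \<le> J"
  shows "branch lam j z \<in> offaxis (c\<^sup>2 + c + \<bar>ln lam\<bar> + pi + 2 * pi * of_int J)"
proof -
  have c1: "1 \<le> c" using assms(1) by (rule offaxis_ge_1)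
  have nz: "z \<noteq> 0" and inz: "Im z \<noteq> 0" using offaxis_Im_nonzero[OF assms(1)] by auto
  have le: "norm z \<le> c" "1 \<le> c * \<bar>Im z\<bar>" using assms(1) by (auto simp: offaxis_def)
  have "1 \<le> c * norm z" using le(2) abs_Im_le_cmod[of z] c1 
    by (smt (verit) mult_left_mono)
  then have lb: "1 / c \<le> norm z" using c1 by (simp add: field_simps)
  have J: "real_of_int \<bar>j\<bar> \<le> of_int J" using assms(2) by (simp only: of_int_le_iff)
  have c0: "c > 0" and nz0: "norm z > 0" using c1 nz by auto
  have "ln (norm z) \<le> ln c" using le nz0 c0 by (simp only: ln_le_cancel_iff)
  moreover have "ln (1 / c) \<le> ln (norm z)" using lb nz0 c0 by (subst ln_le_cancel_iff) auto
  moreover have "ln c \<le> c" using ln_le_minus_one[of c] c0 by linarith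
  ultimately have "\<bar>ln (norm z)\<bar> \<le> c" using c1 by (simp add: ln_div)
  then have re: "\<bar>Re (branch lam j z)\<bar> \<le> c + \<bar>ln lam\<bar>" using nz by (simp add: Re_branch)
  have "\<bar>Im (Ln (z / of_real lam))\<bar> \<le> pi"
    using mpi_less_Im_Ln[of "z / of_real lam"] Im_Ln_le_pi[of "z / of_real lam"] nz lam_pos by auto
  moreover have "\<bar>2 * pi * real_of_int j\<bar> \<le> 2 * pi * of_int J" using J by (simp add: abs_mult)
  ultimately have im: "\<bar>Im (branch lam j z)\<bar> \<le> pi + 2 * pi * of_int J" by (simp add: Im_branch)
  have fold_upper: "norm (branch lam j z) \<le> c + \<bar>ln lam\<bar> + (pi + 2 * pi * of_int J)"
    using cmod_le[of "branch lam j z"] re im by linarith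
  have sq: "1 \<le> c\<^sup>2" using c1 by simp
  have lo: "1 / c\<^sup>2 \<le> \<bar>Im (branch lam j z)\<bar>"
  proof (cases "j = 0")
    case False
    have "pi \<le> \<bar>Im (branch lam j z)\<bar>"
    proof (cases "j > 0")
      case True
      then have "real_of_int j \<ge> 1" by simp
      then have "1 * pi \<le> (2 * real_of_int j - 1) * pi" by (intro mult_right_mono) auto
      then show ?thesis using branch_in_strip[OF nz, of j] unfolding strip_def mem_Collect_eq
        by linarith
    next
      case False
      then have "real_of_int j \<le> -1" using \<open>j \<noteq> 0\<close> by linarith
      then have "(2 * real_of_int j + 1) * pi \<le> (-1) * pi" by (intro mult_right_mono) auto
      then show ?thesis using branch_in_strip[OF nz, of j] unfolding strip_def mem_Collect_eq
        by linarith
    qed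
    moreover have "1 / c\<^sup>2 \<le> 1" using sq c0 by (simp add: field_simps)
    ultimately show ?thesis using pi_ge_two by linarith
  next
    case True
    have e: "z = of_real lam * exp (branch lam j z)" using E_branch[OF nz, of j] by (simp add: E_def)
    have "Im z = norm z * sin (Im (branch lam j z))"
    proof -
      have "norm z = lam * exp (Re (branch lam j z))" using norm_E[of "branch lam j z"] E_branch[OF nz, of j] by simp
      moreover have "Im z = lam * (exp (Re (branch lam j z)) * sin (Im (branch lam j z)))"
        by (subst e) (simp add: Im_exp)
      ultimately show ?thesis by simp
    qed
    then have "\<bar>Im z\<bar> \<le> norm z * \<bar>Im (branch lam j z)\<bar>"
      by (simp add: abs_mult mult_left_mono abs_sin_x_le_abs_x)
    also have "\<dots> \<le> c * \<bar>Im (branch lam j z)\<bar>" using le by (simp add: mult_right_mono)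
    finally have "c * \<bar>Im z\<bar> \<le> c * (c * \<bar>Im (branch lam j z)\<bar>)" using c0 by (intro mult_left_mono) auto
    then have "1 \<le> c\<^sup>2 * \<bar>Im (branch lam j z)\<bar>" using le(2) by (simp add: power2_eq_square)
    then show ?thesis using c0 by (simp add: field_simps)
  qed
  have "0 \<le> real_of_int J" using J abs_ge_zero[of "real_of_int j"] by simp
  then have J0: "0 \<le> of_int J * pi" by simp
  show ?thesis
  proof (rule in_offaxisI[OF _ lo])
    show "norm (branch lam j z) \<le> c\<^sup>2 + c + \<bar>ln lam\<bar> + pi + 2 * pi * of_int J" using fold_upper sq by linarith
    have "c\<^sup>2 \<le> c\<^sup>2 + c + \<bar>ln lam\<bar> + pi + 2 * pi * of_int J" using c0 J0 pi_gt_zero 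
      by (simp add: algebra_simps)
    then show "1 \<le> (c\<^sup>2 + c + \<bar>ln lam\<bar> + pi + 2 * pi * of_int J) * (1 / c\<^sup>2)"
      using c0 by (simp add: field_simps)
  qed
qed

lemma pull_offaxis:
  "\<exists>c'\<ge>c. \<forall>xs z. length xs \<le> l \<and> (\<forall>x\<in>set xs. \<bar>x\<bar> \<le> J) \<and> z \<in> offaxis c \<longrightarrow> pull lam xs z \<in> offaxis c'"
proof (induction l)
  case 0
  then show ?case by auto
next
  case (Suc l)
  then obtain c' where c': "c' \<ge> c" 
    "\<And>xs z. length xs \<le> l \<Longrightarrow> (\<forall>x\<in>set xs. \<bar>x\<bar> \<le> J) \<Longrightarrow> z \<in> offaxis c \<Longrightarrow> pull lam xs z \<in> offaxis c'"
    by blast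
  define c'' where "c'' = c'\<^sup>2 + c' + \<bar>ln lam\<bar> + pi + 2 * pi * of_int J"
  show ?case
  proof (intro exI[of _ "max c' c''"] conjI allI impI)
    show "c \<le> max c' c''" using c' by simp
    fix xs z assume a: "length xs \<le> Suc l \<and> (\<forall>x\<in>set xs. \<bar>x\<bar> \<le> J) \<and> z \<in> offaxis c"
    show "pull lam xs z \<in> offaxis (max c' c'')"
    proof (cases xs)
      case Nil
      then show ?thesis using a c'(2)[of "[]"] offaxis_mono[of c' "max c' c''"] by auto
    next
      case (Cons x ys)
      then have "pull lam xs z \<in> offaxis c''"
        using branch_offaxis[OF c'(2)[of ys z], of x J] a by (simp add: c''_def)
      then show ?thesis using offaxis_mono[of c'' "max c' c''"] by auto
    qed
  qed
qed

end

section \<open>The fixed point in the upper half plane\<close>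

text \<open>Off the real axis \<open>branch lam 0\<close> commutes with conjugation, so reflecting
  into the upper half plane lets one fixed point stand for the conjugate pair.\<close>

definition fold_upper :: "complex \<Rightarrow> complex" where
  "fold_upper z = Complex (Re z) \<bar>Im z\<bar>"

lemma fold_upper_cases: "fold_upper z = (if Im z \<ge> 0 then z else cnj z)"
  by (auto simp: fold_upper_def complex_eq_iff)

lemma fold_upper_in_offaxis_iff [simp]: "fold_upper z \<in> offaxis c \<longleftrightarrow> z \<in> offaxis c"
  by (auto simp: fold_upper_cases offaxis_def)

lemma sin_less_arg:
  fixes x :: real
  assumes "0 < x" "x < pi"
  shows "sin x < x"
proof -
  have "sin x = 2 * sin (x / 2) * cos (x / 2)" using sin_double[of "x / 2"] by simp
  also have "\<dots> \<le> x * cos (x / 2)"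
    using assms sin_x_le_x[of "x / 2"] cos_gt_zero[of "x / 2"] by (intro mult_right_mono) auto
  also have "\<dots> < x * 1"
    using assms cos_monotone_0_pi[of 0 "x / 2"] by (intro mult_strict_left_mono) auto
  finally show ?thesis by simp
qed

context exp_map
begin

lemma fold_upper_branch_0: "Im z \<noteq> 0 \<Longrightarrow> fold_upper (branch lam 0 z) = branch lam 0 (fold_upper z)"
  using Im_branch_0_pos[of z] Im_branch_0_neg[of z] by (auto simp: fold_upper_cases branch_0_cnj)

lemma branch_0_iter_Im_nonzero: "Im z \<noteq> 0 \<Longrightarrow> Im ((branch lam 0 ^^ n) z) \<noteq> 0"
  by (induction n) (auto simp: branch_Im_nonzero)

lemma fold_upper_branch_0_iter: "Im z \<noteq> 0 \<Longrightarrow> fold_upper ((branch lam 0 ^^ n) z) = (branch lam 0 ^^ n) (fold_upper z)"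
  by (induction n) (auto simp: fold_upper_branch_0 branch_0_iter_Im_nonzero)

lemma branch_0_iter_Im_pos: "Im z > 0 \<Longrightarrow> Im ((branch lam 0 ^^ n) z) > 0"
  by (induction n) (auto simp: Im_branch_0_pos)

text \<open>Eliminating \<open>x = y cot y\<close> from the fixed point equation leaves
  \<open>\<phi> y = ln lam\<close>. As \<open>\<phi>\<close> tends to \<open>-1\<close> at
  \<open>0\<close> and to infinity at \<open>pi\<close>, the intermediate value theorem applies when
  \<open>ln lam > -1\<close>, which is the hypothesis on \<open>lam\<close>.\<close>

lemma upper_fixed_point_exists: "\<exists>q. E lam q = q \<and> 0 < Im q \<and> Im q < pi"
proof -
  define \<phi> where "\<phi> = (\<lambda>y::real. ln (y / sin y) - y * cos y / sin y)"
  have l0: "(\<phi> \<longlongrightarrow> -1) (at_right 0)" unfolding \<phi>_def by real_asymp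
  have l1: "filterlim \<phi> at_top (at_left pi)" unfolding \<phi>_def by real_asymp
  have "eventually (\<lambda>y. \<phi> y < ln lam \<and> y \<in> {0<..<1}) (at_right 0)"
    using order_tendstoD(2)[OF l0, of "ln lam"] ln_lam eventually_at_right_real[of 0 1]
    by (auto intro: eventually_conj)
  then obtain y1 where y1: "\<phi> y1 < ln lam" "0 < y1" "y1 < 1"
    using eventually_happens trivial_limit_at_right_real by (metis (mono_tags, lifting) greaterThanLessThan_iff)
  have "eventually (\<lambda>y. \<phi> y \<ge> ln lam \<and> y \<in> {1<..<pi}) (at_left pi)"
    using l1[unfolded filterlim_at_top, rule_format, of "ln lam"] pi_gt3 eventually_at_left_real[of 1 pi]
    by (auto intro: eventually_conj)
  then obtain y2 where y2: "\<phi> y2 \<ge> ln lam" "1 < y2" "y2 < pi"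
    using eventually_happens trivial_limit_at_left_real by (metis (mono_tags, lifting) greaterThanLessThan_iff)
  have s: "sin y > 0" if "y1 \<le> y" "y \<le> y2" for y using that y1 y2 by (intro sin_gt_zero) auto
  have "continuous_on {y1..y2} \<phi>" unfolding \<phi>_def
    using y1 s by (intro continuous_intros) (auto simp: less_imp_neq[THEN not_sym])
  then obtain y where y: "y1 \<le> y" "y \<le> y2" "\<phi> y = ln lam"
    using IVT'[of \<phi> y1 "ln lam" y2] y1 y2 by auto
  have sy: "sin y > 0" and y0: "y > 0" "y < pi" using s y y1 y2 by auto
  define x where "x = y * cos y / sin y"
  have "lam = exp (\<phi> y)" using y lam_pos by simp
  also have "\<phi> y = ln (y / sin y) + - x" by (simp add: \<phi>_def x_def)
  also have "exp \<dots> = (y / sin y) * exp (- x)" using sy y0 by (simp only: exp_add) simp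
  finally have l: "lam * exp x = y / sin y" by (simp add: exp_minus field_simps)
  have "E lam (Complex x y) = of_real (lam * exp x) * cis y"
    by (simp add: E_def exp_eq_polar)
  also have "\<dots> = Complex x y" unfolding l using sy by (simp add: complex_eq_iff x_def)
  finally show ?thesis using y0 by (intro exI[of _ "Complex x y"]) auto
qed

end

section \<open>Hyperbolic contraction towards the fixed point\<close>

locale exp_map_fixed = exp_map +
  fixes q :: complex
  assumes E_q: "E lam q = q" and Im_q: "0 < Im q" "Im q < pi"
begin

definition cayley :: "complex \<Rightarrow> complex" where
  "cayley z = (z - q) / (z - cnj q)"

lemma q_strip: "q \<in> strip 0"
  using Im_q by (auto simp: strip_def)

lemma branch_q: "branch lam 0 q = q"
  using branch_E[OF q_strip] E_q by simp

lemma diff_cnj_q_nonzero: "Im z > 0 \<Longrightarrow> z - cnj q \<noteq> 0"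
  using Im_q by (auto simp: complex_eq_iff)

lemma norm_sq_cayley: "Im z > 0 \<Longrightarrow> (norm (cayley z))\<^sup>2 = 1 - 4 * Im z * Im q / (norm (z - cnj q))\<^sup>2"
proof -
  assume z: "Im z > 0"
  have "(norm (z - cnj q))\<^sup>2 = (norm (z - q))\<^sup>2 + 4 * Im z * Im q"
    unfolding cmod_power2 by (simp add: power2_eq_square algebra_simps)
  then have "(norm (z - q))\<^sup>2 = (norm (z - cnj q))\<^sup>2 - 4 * Im z * Im q" by simp
  moreover have "(norm (cayley z))\<^sup>2 = (norm (z - q))\<^sup>2 / (norm (z - cnj q))\<^sup>2"
    by (simp add: cayley_def norm_divide power_divide)
  ultimately show ?thesis using diff_cnj_q_nonzero[OF z] by (simp add: diff_divide_distrib)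
qed

lemma norm_cayley_less_1: "Im z > 0 \<Longrightarrow> norm (cayley z) < 1"
proof -
  assume z: "Im z > 0"
  have "4 * Im z * Im q / (norm (z - cnj q))\<^sup>2 > 0" using z Im_q diff_cnj_q_nonzero[OF z] by simp
  then have "(norm (cayley z))\<^sup>2 < 1\<^sup>2" using norm_sq_cayley[OF z] by simp
  then show ?thesis by (rule power_less_imp_less_base) simp
qed

lemma cayley_inverse: "Im z > 0 \<Longrightarrow> (q - cnj q * cayley z) / (1 - cayley z) = z"
proof -
  assume z: "Im z > 0"
  define p d where "p = cnj q" and "d = z - p"
  have d: "d \<noteq> 0" using diff_cnj_q_nonzero[OF z] by (simp add: d_def p_def)
  have D: "q - p \<noteq> 0" using Im_q by (auto simp: complex_eq_iff p_def)
  have c: "cayley z = (z - q) / d" by (simp add: cayley_def d_def p_def)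
  have "q - p * cayley z = (q * d - p * (z - q)) / d"
    using d by (simp add: c diff_divide_distrib[of "q * d"])
  also have "q * d - p * (z - q) = z * (q - p)" by (simp add: d_def algebra_simps)
  finally have 1: "q - p * cayley z = z * (q - p) / d" .
  have "1 - cayley z = (d - (z - q)) / d"
    using d by (simp add: c diff_divide_distrib)
  also have "d - (z - q) = q - p" by (simp add: d_def)
  finally have 2: "1 - cayley z = (q - p) / d" .
  have "(q - p * cayley z) / (1 - cayley z) = z" unfolding 1 2 using d D by simp
  then show ?thesis by (simp only: p_def)
qed

lemma inverse_cayley_Im_pos:
  assumes "norm \<zeta> < 1"
  shows "Im ((q - cnj q * \<zeta>) / (1 - \<zeta>)) > 0"
proof -
  have n: "1 - \<zeta> \<noteq> 0" using assms by auto
  have "Im ((q - cnj q * \<zeta>) / (1 - \<zeta>)) = Im ((q - cnj q * \<zeta>) * cnj (1 - \<zeta>)) / (norm (1 - \<zeta>))\<^sup>2"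
    by (subst complex_div_cnj) (simp only: of_real_power [symmetric] Im_divide_of_real)
  also have "Im ((q - cnj q * \<zeta>) * cnj (1 - \<zeta>)) = Im q * (1 - (norm \<zeta>)\<^sup>2)"
    unfolding cmod_power2 by (simp add: power2_eq_square algebra_simps)
  finally show ?thesis using n Im_q assms by (simp add: power_less_one_iff abs_square_less_1)
qed

text \<open>Conjugated to the unit disc with \<open>q\<close> at the centre,
  \<open>branch lam 0\<close> becomes a self-map \<open>f\<close> fixing \<open>0\<close>. It is no
  rotation because it misses part of the half plane, so the Schwarz lemma gives
  \<open>f \<zeta> = \<zeta> * h \<zeta>\<close> with \<open>norm (h \<zeta>) < 1\<close>; the
  factor \<open>k\<close> is the maximum of \<open>norm (h \<zeta>)\<close> on a smaller closed
  disc.\<close>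

lemma cayley_contraction:
  assumes "r < 1"
  shows "\<exists>k. 0 \<le> k \<and> k < 1 \<and> (\<forall>z. Im z > 0 \<and> norm (cayley z) \<le> r \<longrightarrow>
    norm (cayley (branch lam 0 z)) \<le> k * norm (cayley z))"
proof -
  define g where "g = (\<lambda>\<zeta>. (q - cnj q * \<zeta>) / (1 - \<zeta>))"
  define f where "f = (\<lambda>\<zeta>. cayley (branch lam 0 (g \<zeta>)))"
  have g_pos: "Im (g \<zeta>) > 0" if "norm \<zeta> < 1" for \<zeta>
    using inverse_cayley_Im_pos[OF that] by (simp add: g_def)
  have g_hol: "g holomorphic_on ball 0 1"
    unfolding g_def by (intro holomorphic_intros) auto
  have b_hol: "(\<lambda>\<zeta>. branch lam 0 (g \<zeta>)) holomorphic_on ball 0 1"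
    unfolding branch_def using lam_pos
  proof (intro holomorphic_intros g_hol)
    fix \<zeta> :: complex assume "\<zeta> \<in> ball 0 1"
    then show "g \<zeta> / of_real lam \<notin> \<real>\<^sub>\<le>\<^sub>0" using g_pos[of \<zeta>] by (intro nonreal_notin_nonpos) auto
  qed auto
  have f_hol: "f holomorphic_on ball 0 1"
    unfolding f_def cayley_def
    by (intro holomorphic_intros b_hol diff_cnj_q_nonzero)
      (use Im_branch_0_pos g_pos in auto)
  have f0: "f 0 = 0" by (simp add: f_def g_def branch_q cayley_def)
  have f_lt: "norm (f \<zeta>) < 1" if "norm \<zeta> < 1" for \<zeta>
    unfolding f_def using Im_branch_0_pos[OF g_pos[OF that]] by (intro norm_cayley_less_1) auto
  have not_rot: "\<not> (\<exists>\<alpha>. (\<forall>z. norm z < 1 \<longrightarrow> f z = \<alpha> * z) \<and> norm \<alpha> = 1)"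
  proof
    assume "\<exists>\<alpha>. (\<forall>z. norm z < 1 \<longrightarrow> f z = \<alpha> * z) \<and> norm \<alpha> = 1"
    then obtain \<alpha> where \<alpha>: "\<And>z. norm z < 1 \<Longrightarrow> f z = \<alpha> * z" "norm \<alpha> = 1" by blast
    \<comment> \<open>A point of the half plane outside the image of \<open>branch lam 0\<close>,
      where imaginary parts stay below \<open>pi\<close>. A rotation would attain
      \<open>cayley w\<close>.\<close>
    define w where "w = Complex 0 (2 * pi)"
    have w: "Im w > 0" by (simp add: w_def)
    have n: "norm (cayley w / \<alpha>) < 1" using norm_cayley_less_1[OF w] \<alpha> by (simp add: norm_divide)
    have "f (cayley w / \<alpha>) = cayley w" using \<alpha>(1)[OF n] \<alpha>(2) by auto
    then have eq: "cayley (branch lam 0 (g (cayley w / \<alpha>))) = cayley w" by (simp add: f_def)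
    have p: "Im (branch lam 0 (g (cayley w / \<alpha>))) > 0" "Im (branch lam 0 (g (cayley w / \<alpha>))) < pi"
      using Im_branch_0_pos[OF g_pos[OF n]] by auto
    have "branch lam 0 (g (cayley w / \<alpha>)) = w"
      using cayley_inverse[OF p(1)] cayley_inverse[OF w] eq by metis
    with p(2) show False by (simp add: w_def)
  qed
  note S = Schwarz_Lemma[OF f_hol f0 f_lt]
  obtain h where h: "h holomorphic_on ball 0 1" "\<And>z. norm z < 1 \<Longrightarrow> f z = z * h z" "deriv f 0 = h 0"
    by (rule Schwarz3[OF f_hol f0]) auto
  have h_lt: "norm (h \<zeta>) < 1" if z: "norm \<zeta> < 1" for \<zeta>
  proof (cases "\<zeta> = 0")
    case True
    have "norm (h 0) \<noteq> 1" "norm (h 0) \<le> 1" using S(2)[of 0] S(3)[of 0] not_rot h(3) by auto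
    with True show ?thesis by simp
  next
    case False
    have "norm (f \<zeta>) \<noteq> norm \<zeta>" "norm (f \<zeta>) \<le> norm \<zeta>"
      using S(1)[of \<zeta>] z S(3)[of 0] not_rot False z by auto
    then have "norm \<zeta> * norm (h \<zeta>) < norm \<zeta> * 1" using h(2)[OF z] by (simp add: norm_mult)
    then show ?thesis using False by simp
  qed
  \<comment> \<open>For negative \<open>r\<close> there is nothing to bound, but the maximum must be
    taken over a non-empty disc.\<close>
  define r' where "r' = max r 0"
  have r': "r' < 1" "0 \<le> r'" using assms by (auto simp: r'_def)
  have "continuous_on (cball 0 r') (\<lambda>\<zeta>. norm (h \<zeta>))"
    using holomorphic_on_imp_continuous_on[OF h(1)] r'
    by (intro continuous_on_norm) (auto intro: continuous_on_subset)
  moreover have "cball (0::complex) r' \<noteq> {}" using r' by auto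
  ultimately obtain \<zeta>0 where z0: "\<zeta>0 \<in> cball 0 r'" "\<And>\<zeta>. \<zeta> \<in> cball 0 r' \<Longrightarrow> norm (h \<zeta>) \<le> norm (h \<zeta>0)"
    using continuous_attains_sup[OF compact_cball] by blast
  show ?thesis
  proof (intro exI[of _ "norm (h \<zeta>0)"] conjI allI impI)
    show "norm (h \<zeta>0) < 1" using z0 r' by (intro h_lt) auto
    fix z assume z: "Im z > 0 \<and> norm (cayley z) \<le> r"
    have c: "norm (cayley z) < 1" using z by (intro norm_cayley_less_1) auto
    have "g (cayley z) = z" using cayley_inverse z by (simp add: g_def)
    then have "norm (cayley (branch lam 0 z)) = norm (h (cayley z)) * norm (cayley z)"
      using h(2)[OF c] by (simp add: f_def norm_mult)
    also have "\<dots> \<le> norm (h \<zeta>0) * norm (cayley z)"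
      using z0(2)[of "cayley z"] z by (intro mult_right_mono) (auto simp: r'_def)
    finally show "norm (cayley (branch lam 0 z)) \<le> norm (h \<zeta>0) * norm (cayley z)" .
  qed auto
qed

lemma fixed_point_unique:
  assumes "E lam z = z" "z \<in> strip 0" "Im z > 0"
  shows "z = q"
proof -
  have b: "branch lam 0 z = z" using branch_E[OF assms(2)] assms(1) by simp
  obtain k where k: "0 \<le> k" "k < 1" "norm (cayley (branch lam 0 z)) \<le> k * norm (cayley z)"
    using cayley_contraction[OF norm_cayley_less_1[OF assms(3)]] assms(3) by blast
  then have "norm (cayley z) * (1 - k) \<le> 0" using b by (simp add: algebra_simps)
  then have "norm (cayley z) = 0" using k(2) by (simp add: mult_le_0_iff)
  then show ?thesis using diff_cnj_q_nonzero[OF assms(3)] by (simp add: cayley_def)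
qed

lemma deriv_E: "deriv (E lam) z = E lam z"
proof -
  have "(E lam has_field_derivative of_real lam * exp z) (at z)"
    unfolding E_def by (auto intro!: derivative_eq_intros)
  then show ?thesis by (auto dest: DERIV_imp_deriv simp: E_def)
qed

text \<open>Since \<open>E lam\<close> is its own derivative, \<open>norm q\<close> is the modulus
  of the multiplier. The imaginary part of the fixed point equation reads
  \<open>Im q = norm q * sin (Im q)\<close>, and \<open>sin y < y\<close>.\<close>

lemma norm_q: "norm q > 1"
proof -
  have "norm q = lam * exp (Re q)" using norm_E[of q] E_q by simp
  moreover have "Im (E lam q) = lam * (exp (Re q) * sin (Im q))" by (simp add: E_def Im_exp)
  ultimately have "Im q = norm q * sin (Im q)" using E_q by simp
  moreover have "sin (Im q) < Im q" using Im_q by (intro sin_less_arg) auto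
  moreover have "sin (Im q) > 0" using Im_q by (intro sin_gt_zero) auto
  ultimately have "1 * sin (Im q) < norm q * sin (Im q)" by simp
  then show ?thesis using \<open>sin (Im q) > 0\<close> by (simp only: mult_less_cancel_right_pos)
qed

lemma q_plus_eq: "q_plus lam = q"
  unfolding q_plus_def
proof (rule the_equality)
  show "q \<in> strip 0 \<and> repelling_fixed_point (E lam) q \<and> 0 < Im q"
    using q_strip Im_q norm_q E_q by (simp add: repelling_fixed_point_def deriv_E)
qed (use fixed_point_unique in \<open>auto simp: repelling_fixed_point_def\<close>)

lemma E_cnj: "E lam (cnj z) = cnj (E lam z)"
  by (simp add: E_def exp_cnj)

lemma q_minus_eq: "q_minus lam = cnj q"
  unfolding q_minus_def
proof (rule the_equality)
  show "cnj q \<in> strip 0 \<and> repelling_fixed_point (E lam) (cnj q) \<and> Im (cnj q) < 0"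
    using Im_q norm_q E_q by (simp add: repelling_fixed_point_def deriv_E E_cnj strip_def)
next
  fix z assume z: "z \<in> strip 0 \<and> repelling_fixed_point (E lam) z \<and> Im z < 0"
  then have "E lam (cnj z) = cnj z" "cnj z \<in> strip 0"
    by (auto simp: repelling_fixed_point_def E_cnj strip_def)
  then have "cnj z = q" using z by (intro fixed_point_unique) auto
  then show "z = cnj q" by auto
qed

lemma norm_diff_q_le:
  assumes "Im z > 0" "norm (cayley z) \<le> 1/2"
  shows "norm (z - q) \<le> 4 * Im q * norm (cayley z)"
proof -
  have "norm (z - q) = norm (cayley z) * norm (z - cnj q)"
    using diff_cnj_q_nonzero[OF assms(1)] by (simp add: cayley_def norm_divide)
  moreover have "norm (z - cnj q) \<le> norm (z - q) + 2 * Im q"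
  proof -
    have "norm (q - cnj q) = 2 * Im q" using Im_q by (simp add: cmod_def complex_eq_iff real_sqrt_mult)
    then show ?thesis using norm_triangle_ineq[of "z - q" "q - cnj q"] by simp
  qed
  ultimately have "norm (z - q) \<le> norm (cayley z) * (norm (z - q) + 2 * Im q)"
    by (simp add: mult_left_mono)
  moreover have "norm (cayley z) * norm (z - q) \<le> 1/2 * norm (z - q)"
    using assms(2) by (rule mult_right_mono) simp
  ultimately show ?thesis by (simp add: algebra_simps)
qed

text \<open>Compactness bounds \<open>norm (cayley (fold_upper z))\<close> by one
  \<open>r < 1\<close> on \<open>offaxis c\<close>. Iteration never leaves that disc, so one factor
  \<open>k\<close> serves every step and every point.\<close>

lemma branch_0_iter_tendsto:
  assumes "\<delta> > 0"
  shows "\<exists>N. \<forall>n\<ge>N. \<forall>z\<in>offaxis c. norm (fold_upper ((branch lam 0 ^^ n) z) - q) < \<delta>"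
proof -
  have "\<exists>r<1. \<forall>z\<in>offaxis c. norm (cayley (fold_upper z)) \<le> r"
  proof (cases "offaxis c = {}")
    case True
    then show ?thesis by (intro exI[of _ 0]) auto
  next
    case False
    have pos: "Im (fold_upper z) > 0" if "z \<in> offaxis c" for z using offaxis_Im_nonzero[OF that] by (simp add: fold_upper_def)
    have "continuous_on (offaxis c) fold_upper" unfolding fold_upper_def Complex_eq by (intro continuous_intros)
    then have "continuous_on (offaxis c) (\<lambda>z. norm (cayley (fold_upper z)))" unfolding cayley_def
      using diff_cnj_q_nonzero[OF pos] by (intro continuous_intros) auto
    then obtain z0 where "z0 \<in> offaxis c" "\<And>z. z \<in> offaxis c \<Longrightarrow> norm (cayley (fold_upper z)) \<le> norm (cayley (fold_upper z0))"
      using continuous_attains_sup[OF compact_offaxis False] by blast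
    then show ?thesis using norm_cayley_less_1[OF pos] by blast
  qed
  then obtain r where r: "r < 1" "\<And>z. z \<in> offaxis c \<Longrightarrow> norm (cayley (fold_upper z)) \<le> r" by blast
  obtain k where k: "0 \<le> k" "k < 1"
    "\<And>z. Im z > 0 \<Longrightarrow> norm (cayley z) \<le> r \<Longrightarrow> norm (cayley (branch lam 0 z)) \<le> k * norm (cayley z)"
    using cayley_contraction[OF r(1)] by blast
  have it: "norm (cayley ((branch lam 0 ^^ n) z)) \<le> k ^ n \<and> norm (cayley ((branch lam 0 ^^ n) z)) \<le> r"
    if z: "Im z > 0" "norm (cayley z) \<le> r" for n z
  proof (induction n)
    case 0
    then show ?case using z r by simp
  next
    case (Suc n)
    let ?w = "(branch lam 0 ^^ n) z"
    have "norm (cayley (branch lam 0 ?w)) \<le> k * norm (cayley ?w)"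
      using Suc z by (intro k(3) branch_0_iter_Im_pos) auto
    moreover have "k * norm (cayley ?w) \<le> k * k ^ n" using Suc k by (intro mult_left_mono) auto
    moreover have "k * norm (cayley ?w) \<le> 1 * norm (cayley ?w)" using k by (intro mult_right_mono) auto
    ultimately show ?case using Suc by auto
  qed
  define e where "e = min (1/2) (\<delta> / (8 * Im q))"
  have "e > 0" using assms Im_q by (simp add: e_def)
  then obtain N where N: "k ^ N < e" using real_arch_pow_inv[OF _ k(2)] by blast
  show ?thesis
  proof (intro exI[of _ N] allI impI ballI)
    fix n z assume n: "N \<le> n" and z: "z \<in> offaxis c"
    have p: "Im (fold_upper z) > 0" and nz: "Im z \<noteq> 0" using offaxis_Im_nonzero[OF z] by (auto simp: fold_upper_def)
    let ?w = "(branch lam 0 ^^ n) (fold_upper z)"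
    have "norm (cayley ?w) \<le> k ^ n" using it[OF p r(2)[OF z]] by blast
    moreover have "k ^ n \<le> k ^ N" using n k by (intro power_decreasing) auto
    ultimately have le: "norm (cayley ?w) \<le> 1/2" "norm (cayley ?w) \<le> \<delta> / (8 * Im q)" 
      using N by (auto simp: e_def)
    have "norm (?w - q) \<le> 4 * Im q * norm (cayley ?w)"
      using le by (intro norm_diff_q_le branch_0_iter_Im_pos p) auto
    also have "\<dots> \<le> 4 * Im q * (\<delta> / (8 * Im q))" using le Im_q by (intro mult_left_mono) auto
    also have "\<dots> < \<delta>" using Im_q assms by simp
    finally show "norm (fold_upper ((branch lam 0 ^^ n) z) - q) < \<delta>" using nz by (simp add: fold_upper_branch_0_iter)
  qed
qed

text \<open>Large enough for the discs of radius \<open>Im q / 2\<close> about \<open>q\<close> and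
  \<open>cnj q\<close> to lie in \<open>offaxis c_q\<close>; the term \<open>2 / Im q\<close>
  answers to their distance \<open>Im q / 2\<close> from the real axis. No itinerary enters, so this
  set can be the target of every zero block.\<close>

definition c_q :: real where
  "c_q = norm q + 1 + 2 / Im q + Im q"

lemma near_q_offaxis:
  assumes "norm (fold_upper z - q) < Im q / 2" 
  shows "z \<in> offaxis c_q"
proof -
  have "Im q / 2 \<le> Im (fold_upper z)"
    using abs_Im_le_cmod[of "fold_upper z - q"] assms by simp
  moreover have "norm (fold_upper z) \<le> c_q"
    using norm_triangle_ineq[of "fold_upper z - q" q] assms Im_q by (simp add: c_q_def)
      (smt (verit) divide_pos_pos)
  moreover have "1 \<le> c_q * (Im q / 2)" 
    using Im_q norm_ge_zero[of q] by (simp add: c_q_def field_simps)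
  ultimately have "fold_upper z \<in> offaxis c_q" by (intro in_offaxisI[where e = "Im q / 2"]) auto
  then show ?thesis by simp
qed

lemma branch_0_iter_offaxis:
  "\<exists>c'\<ge>c. \<forall>n. \<forall>z\<in>offaxis c. (branch lam 0 ^^ n) z \<in> offaxis c'"
proof -
  obtain N where N: "\<And>n z. n \<ge> N \<Longrightarrow> z \<in> offaxis c \<Longrightarrow> norm (fold_upper ((branch lam 0 ^^ n) z) - q) < Im q / 2"
    using branch_0_iter_tendsto[of "Im q / 2" c] Im_q by auto
  obtain c' where c': "c' \<ge> c" "\<And>xs z. length xs \<le> N \<Longrightarrow> (\<forall>x\<in>set xs. \<bar>x\<bar> \<le> 0) \<Longrightarrow> z \<in> offaxis c
      \<Longrightarrow> pull lam xs z \<in> offaxis c'"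
    using pull_offaxis[of c N 0] by blast
  show ?thesis
  proof (intro exI[of _ "max c' c_q"] conjI allI ballI)
    fix n z assume z: "z \<in> offaxis c"
    show "(branch lam 0 ^^ n) z \<in> offaxis (max c' c_q)"
    proof (cases "n \<ge> N")
      case True
      then show ?thesis using near_q_offaxis[OF N[OF True z]] offaxis_mono[of c_q "max c' c_q"] by auto
    next
      case False
      then have "pull lam (replicate n 0) z \<in> offaxis c'" using z by (intro c') auto
      then show ?thesis using offaxis_mono[of c' "max c' c_q"] by (auto simp: pull_replicate)
    qed
  qed (use c' in auto)
qed

text \<open>The number \<open>n\<close> of zeros is quantified after \<open>c'\<close>. Hence the
  radius for a block can be fixed before the length of the zero block that follows it.\<close>

lemma pull_zeros_offaxis:
  "\<exists>c'\<ge>c. \<forall>xs n. \<forall>z\<in>offaxis c. length xs \<le> l \<and> (\<forall>x\<in>set xs. \<bar>x\<bar> \<le> J) \<longrightarrow> 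
     pull lam (xs @ replicate n 0) z \<in> offaxis c'"
proof -
  obtain c' where c': "c' \<ge> c" "\<And>n z. z \<in> offaxis c \<Longrightarrow> (branch lam 0 ^^ n) z \<in> offaxis c'"
    using branch_0_iter_offaxis[of c] by blast
  obtain c'' where "c'' \<ge> c'" "\<And>xs z. length xs \<le> l \<Longrightarrow> (\<forall>x\<in>set xs. \<bar>x\<bar> \<le> J) \<Longrightarrow> z \<in> offaxis c'
      \<Longrightarrow> pull lam xs z \<in> offaxis c''"
    using pull_offaxis[of c' l J] by blast
  with c' show ?thesis by (intro exI[of _ c'']) (auto simp: pull_replicate)
qed

end

section \<open>Points following an orbit of \<open>exp - 1\<close>\<close>

definition F :: "real \<Rightarrow> real" where
  "F t = exp t - 1"

lemma F_ge: "0 \<le> x \<Longrightarrow> x + x\<^sup>2 / 2 \<le> F x"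
  using exp_lower_Taylor_quadratic[of x] by (simp add: F_def)

lemma F_strict_mono: "x < y \<Longrightarrow> F x < F y"
  by (simp add: F_def)

lemma F_iter_strict_mono: "x < y \<Longrightarrow> (F ^^ n) x < (F ^^ n) y"
  by (induction n) (auto intro: F_strict_mono)

lemma F_iter_mono: "x \<le> y \<Longrightarrow> (F ^^ n) x \<le> (F ^^ n) y"
  using F_iter_strict_mono[of x y n] by (cases "x = y") auto

lemma continuous_F_iter: "isCont (F ^^ n) t"
proof (induction n arbitrary: t)
  case 0
  then show ?case by (simp add: id_def)
next
  case (Suc n)
  have "isCont (\<lambda>t. F ((F ^^ n) t)) t"
    unfolding F_def[of "(F ^^ n) _"] by (intro continuous_intros Suc)
  then show ?case by (simp add: o_def)
qed

text \<open>The fixed point \<open>0\<close> of \<open>F\<close> is neutral, so growth near it is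
  not automatic; but \<open>F x\<close> is at least \<open>x * (1 + x / 2)\<close> and the orbit
  stays above \<open>t\<close>, so each step gains the factor \<open>1 + t / 2\<close>.\<close>

lemma F_iter_growth: "0 < t \<Longrightarrow> t * (1 + t / 2) ^ n \<le> (F ^^ n) t"
proof (induction n)
  case (Suc n)
  let ?x = "(F ^^ n) t"
  have "1 \<le> (1 + t / 2) ^ n" using Suc.prems by (intro one_le_power) auto
  then have "t * 1 \<le> t * (1 + t / 2) ^ n" using Suc.prems by (intro mult_left_mono) auto
  then have x: "t \<le> ?x" using Suc by linarith
  have "t * (1 + t / 2) ^ Suc n = t * (1 + t / 2) ^ n * (1 + t / 2)" by simp
  also have "\<dots> \<le> ?x * (1 + ?x / 2)" using x Suc by (intro mult_mono) auto
  also have "\<dots> \<le> F ?x" using F_ge[of ?x] x Suc.prems by (simp add: algebra_simps power2_eq_square)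
  finally show ?case by simp
qed simp

lemma F_iter_superlinear:
  assumes "0 < t"
  shows "\<exists>k. \<forall>n\<ge>k. A * (real n + 1) \<le> (F ^^ n) t"
proof -
  define \<rho> where "\<rho> = 1 + t / 2"
  have \<rho>: "\<rho> > 1" using assms by (simp add: \<rho>_def)
  have "eventually (\<lambda>n. A * (real n + 1) \<le> t * \<rho> ^ n) sequentially"
    using \<rho> assms by real_asymp
  then obtain k where "\<And>n. n \<ge> k \<Longrightarrow> A * (real n + 1) \<le> t * \<rho> ^ n"
    by (auto simp: eventually_sequentially)
  then show ?thesis using F_iter_growth[OF assms] unfolding \<rho>_def by (meson order_trans)
qed

text \<open>The quadratic term of \<open>F_ge\<close> adds at least \<open>A\<close> per step. What
  matters is that the bound starts at time \<open>0\<close> for all large \<open>t\<close>; the hair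
  near infinity is controlled by this.\<close>

lemma F_iter_large:
  assumes "A \<ge> 2" "A \<le> t"
  shows "A * (real n + 1) \<le> (F ^^ n) t"
proof (induction n)
  case 0
  then show ?case using assms by simp
next
  case (Suc n)
  let ?x = "(F ^^ n) t"
  have "A * 1 \<le> A * (real n + 1)" using assms by (intro mult_left_mono) auto
  then have x: "A \<le> ?x" using Suc by linarith
  have "A * 2 \<le> ?x\<^sup>2" using x assms mult_mono[of A ?x 2 ?x] by (simp add: power2_eq_square)
  then show ?case using F_ge[of ?x] x Suc assms by (simp add: algebra_simps)
qed

lemma norm_Ln_diff_le:
  assumes "R > 0" "R \<le> Re w" "R \<le> Re w'"
  shows "norm (Ln w - Ln w') \<le> norm (w - w') / R"
proof -
  have "norm (Ln w - Ln w') \<le> (1 / R) * norm (w - w')"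
  proof (rule field_differentiable_bound[of "{z. R \<le> Re z}"])
    show "convex {z. R \<le> Re z}" using convex_halfspace_Re_ge[of R] by simp
    fix z assume "z \<in> {z. R \<le> Re z}"
    then have z: "R \<le> Re z" by simp
    then have "z \<notin> \<real>\<^sub>\<le>\<^sub>0" using assms by (auto simp: complex_nonpos_Reals_iff)
    then show "(Ln has_field_derivative inverse z) (at z within {z. R \<le> Re z})"
      by (rule has_field_derivative_Ln[THEN has_field_derivative_at_within])
    have "R \<le> norm z" using z complex_Re_le_cmod[of z] by linarith
    then show "norm (inverse z) \<le> 1 / R" using assms le_imp_inverse_le[of R "norm z"]
      by (simp add: norm_inverse inverse_eq_divide[of R])
  qed (use assms in auto)
  then show ?thesis by simp
qed

section \<open>Contraction of backward orbits far to the right\<close>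

context exp_map
begin

lemma branch_eq_Ln:
  assumes "w \<noteq> 0"
  shows "branch lam j w = Ln w - of_real (ln lam) + of_real (2 * pi * of_int j) * \<i>"
  using lam_pos assms by (simp add: branch_def Ln_divide_of_real Ln_of_real)

lemma branch_contraction:
  assumes "2 \<le> Re w" "2 \<le> Re w'"
  shows "norm (branch lam j w - branch lam j w') \<le> norm (w - w') / 2"
proof -
  have "w \<noteq> 0" "w' \<noteq> 0" using assms by auto
  then show ?thesis using norm_Ln_diff_le[of 2 w w'] assms by (simp add: branch_eq_Ln)
qed

lemma backward_contraction:
  assumes "k \<le> n"
    and "\<And>i. \<lbrakk>k \<le> i; i < n\<rbrakk> \<Longrightarrow> x i = branch lam (s i) (x (Suc i)) \<and> 2 \<le> Re (x (Suc i))"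
    and "\<And>i. \<lbrakk>k \<le> i; i < n\<rbrakk> \<Longrightarrow> y i = branch lam (s i) (y (Suc i)) \<and> 2 \<le> Re (y (Suc i))"
  shows "norm (x k - y k) \<le> norm (x n - y n) / 2 ^ (n - k)"
  using assms(1)
proof (induction rule: inc_induct)
  case base
  then show ?case by simp
next
  case (step i)
  have "norm (x i - y i) \<le> norm (x (Suc i) - y (Suc i)) / 2"
    using assms(2,3)[of i] step branch_contraction by metis
  also have "\<dots> \<le> (norm (x n - y n) / 2 ^ (n - Suc i)) / 2" using step by simp
  also have "\<dots> = norm (x n - y n) / 2 ^ Suc (n - Suc i)" by (simp add: mult.commute)
  also have "Suc (n - Suc i) = n - i" using step by simp
  finally show ?case .
qed

end

text \<open>\<open>slow\<close> keeps the imaginary parts of orbits linear in time,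
  \<open>nonzero\<close> keeps orbits off the real axis and so away from the cuts of the branches,
  and \<open>long_runs\<close> gives an escaping orbit the time to let its real part overtake the
  index.\<close>

locale slow_itinerary = exp_map +
  fixes s :: "nat \<Rightarrow> int"
  assumes slow: "\<bar>s k\<bar> \<le> int k"
    and nonzero: "\<exists>k\<ge>m. s k \<noteq> 0"
    and long_runs: "\<exists>a\<ge>m. \<exists>N\<ge>a. 1 \<le> N \<and> (\<forall>i. a \<le> i \<and> i < a + N \<longrightarrow> s i = 0)"
begin

text \<open>The parameter \<open>t\<close> is the potential of the point, its rate of escape. The
  error may grow linearly because the imaginary parts may; orbits of \<open>F\<close> with
  \<open>t > 0\<close> outgrow any linear function.\<close>

definition follows :: "real \<Rightarrow> complex \<Rightarrow> bool" where
  "follows t z \<longleftrightarrow> z \<in> itinerary_set lam s \<and>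
    (\<exists>K k. \<forall>n\<ge>k. norm ((E lam ^^ n) z - of_real ((F ^^ n) t)) \<le> K * (real n + 1))"

lemma slow_real: "\<bar>real_of_int (s k)\<bar> \<le> real k"
  using slow[of k] by linarith

lemma abs_Im_orbit: "z \<in> itinerary_set lam s \<Longrightarrow> \<bar>Im ((E lam ^^ n) z)\<bar> \<le> (2 * real n + 1) * pi"
proof -
  assume "z \<in> itinerary_set lam s"
  then have "\<bar>Im ((E lam ^^ n) z)\<bar> \<le> (2 * \<bar>real_of_int (s n)\<bar> + 1) * pi"
    by (intro abs_Im_strip) (simp add: itinerary_set_def)
  also have "\<dots> \<le> (2 * real n + 1) * pi" using slow_real[of n] by (intro mult_right_mono) auto
  finally show ?thesis .
qed

text \<open>At some later time the orbit is in a strip of non-zero index, which misses the real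
  axis, and branches carry non-real points to non-real points.\<close>

lemma orbit_Im_nonzero: 
  assumes "z \<in> itinerary_set lam s"
  shows "Im ((E lam ^^ n) z) \<noteq> 0"
proof -
  obtain m where m: "m \<ge> n" "s m \<noteq> 0" using nonzero by blast
  have "Im ((E lam ^^ m) z) \<noteq> 0" using assms m by (intro strip_Im_nonzero[of _ "s m"]) (auto simp: itinerary_set_def)
  then have "Im (pull lam (map s [n..<m]) ((E lam ^^ m) z)) \<noteq> 0" by (rule pull_Im_nonzero)
  then show ?thesis using assms m by (subst (asm) pull_seg_orbit) (auto simp: itinerary_set_def)
qed

lemma orbit_backward: "z \<in> itinerary_set lam s \<Longrightarrow> (E lam ^^ n) z = branch lam (s n) ((E lam ^^ Suc n) z)"
  by (simp add: branch_E itinerary_set_def)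

lemma orbit_pull:
  "z \<in> itinerary_set lam s \<Longrightarrow> i \<le> j \<Longrightarrow> pull lam (map s [i..<j]) ((E lam ^^ j) z) = (E lam ^^ i) z"
  by (intro pull_seg_orbit) (auto simp: itinerary_set_def)

lemma orbit_pull_0: "z \<in> itinerary_set lam s \<Longrightarrow> pull lam (map s [0..<j]) ((E lam ^^ j) z) = z"
  using orbit_pull[of z 0 j] by simp

lemma linear_over_pow2_tendsto_0: "(\<lambda>m. K * (real (k + m) + 1) / 2 ^ m) \<longlonglongrightarrow> 0"
proof -
  have "(\<lambda>m. K * (real k + real m + 1) / 2 ^ m) \<longlonglongrightarrow> 0" by real_asymp
  then show ?thesis by (simp only: of_nat_add)
qed

lemma nonpos_if_le_linear_over_pow2:
  assumes "\<And>m. d \<le> K * (real (k + m) + 1) / 2 ^ m"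
  shows "d \<le> 0"
  by (rule LIMSEQ_le_const[OF linear_over_pow2_tendsto_0]) (use assms in blast)

lemma orbit_contraction:
  assumes "z \<in> itinerary_set lam s" "z' \<in> itinerary_set lam s"
    and "\<And>n. n \<ge> k \<Longrightarrow> 2 \<le> Re ((E lam ^^ n) z)" "\<And>n. n \<ge> k \<Longrightarrow> 2 \<le> Re ((E lam ^^ n) z')"
  shows "norm ((E lam ^^ k) z - (E lam ^^ k) z')
    \<le> norm ((E lam ^^ (k + m)) z - (E lam ^^ (k + m)) z') / 2 ^ m"
proof -
  have "norm ((E lam ^^ k) z - (E lam ^^ k) z')
    \<le> norm ((E lam ^^ (k + m)) z - (E lam ^^ (k + m)) z') / 2 ^ (k + m - k)"
  proof (rule backward_contraction[where s = s], goal_cases)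
    case (2 i)
    then show ?case using assms(3)[of "Suc i"] by (intro conjI orbit_backward[OF assms(1)]) auto
  next
    case (3 i)
    then show ?case using assms(4)[of "Suc i"] by (intro conjI orbit_backward[OF assms(2)]) auto
  qed simp
  then show ?thesis by simp
qed

text \<open>Going back from time \<open>k + m\<close> to time \<open>k\<close> divides a distance
  linear in \<open>m\<close> by \<open>2 ^ m\<close>. With \<open>m\<close> arbitrary the orbits
  agree at time \<open>k\<close>, and the branches carry this back to time \<open>0\<close>.\<close>

lemma itinerary_points_eq:
  assumes "z \<in> itinerary_set lam s" "z' \<in> itinerary_set lam s"
    and "\<And>n. n \<ge> k \<Longrightarrow> 2 \<le> Re ((E lam ^^ n) z) \<and> 2 \<le> Re ((E lam ^^ n) z') \<and>
      norm ((E lam ^^ n) z - (E lam ^^ n) z') \<le> K * (real n + 1)"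
  shows "z = z'"
proof -
  let ?d = "norm ((E lam ^^ k) z - (E lam ^^ k) z')"
  have "?d \<le> K * (real (k + m) + 1) / 2 ^ m" for m
  proof -
    have "?d \<le> norm ((E lam ^^ (k + m)) z - (E lam ^^ (k + m)) z') / 2 ^ m"
      using assms by (intro orbit_contraction) auto
    also have "\<dots> \<le> K * (real (k + m) + 1) / 2 ^ m"
      using assms(3)[of "k + m"] by (intro divide_right_mono) auto
    finally show ?thesis by simp
  qed
  then have "?d \<le> 0"
    by (rule nonpos_if_le_linear_over_pow2)
  then have eq: "(E lam ^^ k) z = (E lam ^^ k) z'" by simp
  have "z = pull lam (map s [0..<k]) ((E lam ^^ k) z)" by (simp only: orbit_pull_0[OF assms(1)])
  also have "\<dots> = z'" by (simp only: eq orbit_pull_0[OF assms(2)])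
  finally show ?thesis .
qed

lemma follows_Re_large:
  assumes "t > 0" "follows t z"
  shows "\<exists>k. \<forall>n\<ge>k. real n + 2 \<le> Re ((E lam ^^ n) z)"
proof -
  obtain K k where K: "\<And>n. n \<ge> k \<Longrightarrow> norm ((E lam ^^ n) z - of_real ((F ^^ n) t)) \<le> K * (real n + 1)"
    using assms(2) by (auto simp: follows_def)
  obtain k' where k': "\<And>n. n \<ge> k' \<Longrightarrow> (K + 2) * (real n + 1) \<le> (F ^^ n) t"
    using F_iter_superlinear[OF assms(1)] by blast
  show ?thesis
  proof (intro exI[of _ "max k k'"] allI impI)
    fix n assume n: "max k k' \<le> n"
    have "\<bar>Re ((E lam ^^ n) z) - (F ^^ n) t\<bar> \<le> K * (real n + 1)"
      using K[of n] abs_Re_le_cmod[of "(E lam ^^ n) z - of_real ((F ^^ n) t)"] n by simp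
    then show "real n + 2 \<le> Re ((E lam ^^ n) z)"
      using k'[of n] n by (simp add: algebra_simps)
  qed
qed

lemma follows_unique:
  assumes "t > 0" "follows t z" "follows t z'"
  shows "z = z'"
proof -
  obtain K k where K: "\<And>n. n \<ge> k \<Longrightarrow> norm ((E lam ^^ n) z - of_real ((F ^^ n) t)) \<le> K * (real n + 1)"
    using assms(2) by (auto simp: follows_def)
  obtain K' k' where K': "\<And>n. n \<ge> k' \<Longrightarrow> norm ((E lam ^^ n) z' - of_real ((F ^^ n) t)) \<le> K' * (real n + 1)"
    using assms(3) by (auto simp: follows_def)
  obtain l where l: "\<And>n. n \<ge> l \<Longrightarrow> real n + 2 \<le> Re ((E lam ^^ n) z)"
    using follows_Re_large[OF assms(1,2)] by blast
  obtain l' where l': "\<And>n. n \<ge> l' \<Longrightarrow> real n + 2 \<le> Re ((E lam ^^ n) z')"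
    using follows_Re_large[OF assms(1,3)] by blast
  show ?thesis
  proof (rule itinerary_points_eq[where k = "max (max k k') (max l l')" and K = "K + K'"])
    fix n assume n: "max (max k k') (max l l') \<le> n"
    have "norm ((E lam ^^ n) z - (E lam ^^ n) z') \<le> (K + K') * (real n + 1)"
      using norm_triangle_ineq4[of "(E lam ^^ n) z - of_real ((F ^^ n) t)" "(E lam ^^ n) z' - of_real ((F ^^ n) t)"]
        K[of n] K'[of n] n by (simp add: algebra_simps)
    then show "2 \<le> Re ((E lam ^^ n) z) \<and> 2 \<le> Re ((E lam ^^ n) z') \<and>
      norm ((E lam ^^ n) z - (E lam ^^ n) z') \<le> (K + K') * (real n + 1)"
      using l[of n] l'[of n] n by auto
  qed (use assms in \<open>auto simp: follows_def\<close>)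
qed

text \<open>Once both orbits of \<open>F\<close> exceed \<open>1\<close>, the derivative of
  \<open>F\<close> between them is at least \<open>2\<close> and their gap doubles at each step.
  Following the same point allows the gap only linear growth.\<close>

lemma follows_inj_aux:
  assumes "0 < t" "t < t'" "follows t z" "follows t' z"
  shows False
proof -
  obtain K k where K: "\<And>n. n \<ge> k \<Longrightarrow> norm ((E lam ^^ n) z - of_real ((F ^^ n) t)) \<le> K * (real n + 1)"
    using assms(3) by (auto simp: follows_def)
  obtain K' k' where K': "\<And>n. n \<ge> k' \<Longrightarrow> norm ((E lam ^^ n) z - of_real ((F ^^ n) t')) \<le> K' * (real n + 1)"
    using assms(4) by (auto simp: follows_def)
  obtain l where l: "\<And>n. n \<ge> l \<Longrightarrow> 1 * (real n + 1) \<le> (F ^^ n) t"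
    using F_iter_superlinear[OF assms(1)] by blast
  define k0 where "k0 = max (max k k') l"
  define D where "D = (\<lambda>n. (F ^^ n) t' - (F ^^ n) t)"
  have pos: "D n > 0" for n using F_iter_strict_mono[OF assms(2)] by (simp add: D_def)
  have le: "D n \<le> (K + K') * (real n + 1)" if "n \<ge> k0" for n
  proof -
    have "norm (of_real (D n) :: complex) \<le> (K + K') * (real n + 1)"
      using norm_triangle_ineq4[of "(E lam ^^ n) z - of_real ((F ^^ n) t)" "(E lam ^^ n) z - of_real ((F ^^ n) t')"]
        K[of n] K'[of n] that by (simp add: algebra_simps D_def k0_def)
    then show ?thesis using pos[of n] by simp
  qed
  have step: "2 * D n \<le> D (Suc n)" if "n \<ge> k0" for n
  proof -
    let ?b = "(F ^^ n) t" and ?a = "(F ^^ n) t'"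
    have b: "1 \<le> ?b" using l[of n] that by (simp add: k0_def)
    have "exp ?b * (1 + (?a - ?b)) \<le> exp ?b * exp (?a - ?b)"
      using exp_ge_add_one_self by (intro mult_left_mono) auto
    also have "\<dots> = exp ?a" by (simp flip: exp_add)
    finally have "exp ?b * D n \<le> D (Suc n)" by (simp add: D_def F_def algebra_simps)
    moreover have "2 \<le> exp ?b" using b exp_ge_add_one_self[of ?b] by linarith
    then have "2 * D n \<le> exp ?b * D n" using pos[of n] by (intro mult_right_mono) auto
    ultimately show ?thesis by simp
  qed
  have "2 ^ m * D k0 \<le> D (k0 + m)" for m
  proof (induction m)
    case (Suc m)
    then show ?case using step[of "k0 + m"] by simp
  qed simp
  then have "D k0 \<le> (K + K') * (real (k0 + m) + 1) / 2 ^ m" for m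
    using le[of "k0 + m"] order_trans by (fastforce simp: field_simps)
  then have "D k0 \<le> 0"
    by (rule nonpos_if_le_linear_over_pow2)
  with pos[of k0] show False by simp
qed

lemma follows_inj:
  assumes "0 < t" "0 < t'" "follows t z" "follows t' z"
  shows "t = t'"
  using follows_inj_aux[of t t' z] follows_inj_aux[of t' t z] assms by (meson linorder_neqE_linordered_idom)

definition K0 :: real where "K0 = 2 * pi + \<bar>ln lam\<bar> + 1"

lemma K0_ge_1: "K0 \<ge> 1"
  using pi_gt_zero by (simp add: K0_def)

text \<open>This is where \<open>K0\<close> comes from: \<open>Ln w\<close> is within \<open>1\<close> of \<open>\<tau>\<close>, the factor \<open>lam\<close> shifts by
  \<open>ln lam\<close>, and the entry of \<open>s\<close> shifts by at most \<open>2 pi i\<close>.\<close>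
lemma branch_near_real:
  assumes T: "(2 * K0 + 2) * (real i + 2) \<le> F \<tau>"
    and w: "norm (w - of_real (F \<tau>)) \<le> K0 * (real i + 2)"
  shows "norm (branch lam (s i) w - of_real \<tau>) \<le> K0 * (real i + 1)"
proof -
  let ?T = "F \<tau>"
  have T0: "?T > 0" using T K0_ge_1 by (smt (verit) mult_pos_pos of_nat_0_le_iff)
  have "\<bar>Re w - ?T\<bar> \<le> K0 * (real i + 2)" using w abs_Re_le_cmod[of "w - of_real ?T"] by simp
  moreover have "2 * (K0 * (real i + 2)) + 2 * (real i + 2) \<le> ?T" using T by (simp add: algebra_simps)
  moreover have "T + 1 \<le> 2 * R" if "\<bar>R - T\<bar> \<le> X" "2 * X + 2 * (real i + 2) \<le> T" for R T X
    using that of_nat_0_le_iff[of i, where 'a = real] by (simp add: abs_le_iff)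
  ultimately have Re: "?T + 1 \<le> 2 * Re w" by blast
  then have w0: "w \<noteq> 0" "Re w > 0" using T0 by auto
  have e: "Ln (of_real (?T + 1)) = of_real \<tau>" by (simp add: F_def Ln_of_real)
  have "norm (Ln w - Ln (of_real (?T + 1))) \<le> norm (w - of_real (?T + 1)) / ((?T + 1) / 2)"
    using Re T0 by (intro norm_Ln_diff_le) auto
  also have "\<dots> \<le> ((?T + 1) / 2) / ((?T + 1) / 2)"
  proof (rule divide_right_mono)
    have "norm (w - of_real (?T + 1)) \<le> norm (w - of_real ?T) + 1"
      using norm_triangle_ineq4[of "w - of_real ?T" 1] by (simp add: algebra_simps)
    then show "norm (w - of_real (?T + 1)) \<le> (?T + 1) / 2"
      using w \<open>2 * (K0 * (real i + 2)) + 2 * (real i + 2) \<le> ?T\<close> by simp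
  qed (use T0 in simp)
  also have "\<dots> = 1" using T0 by simp
  finally have 1: "norm (Ln w - of_real \<tau>) \<le> 1" unfolding e .
  have "norm (branch lam (s i) w - of_real \<tau>)
     \<le> norm (Ln w - of_real \<tau>) + norm (of_real (ln lam) :: complex) + norm (of_real (2 * pi * of_int (s i)) * \<i>)"
    unfolding branch_eq_Ln[OF w0(1)]
    using norm_triangle_ineq[of "Ln w - of_real \<tau> - of_real (ln lam)" "of_real (2 * pi * of_int (s i)) * \<i>"]
      norm_triangle_ineq4[of "Ln w - of_real \<tau>" "of_real (ln lam)"]
    by (simp add: algebra_simps)
  also have "norm (of_real (2 * pi * of_int (s i)) * \<i>) = 2 * pi * \<bar>real_of_int (s i)\<bar>"
    by (simp add: norm_mult abs_mult)
  also have "\<dots> \<le> 2 * pi * real i" using slow_real[of i] by simp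
  finally have "norm (branch lam (s i) w - of_real \<tau>) \<le> 1 + \<bar>ln lam\<bar> + 2 * pi * real i" using 1 by simp
  also have "\<dots> \<le> K0 * (real i + 1)" by (simp add: K0_def algebra_simps)
  finally show "norm (branch lam (s i) w - of_real \<tau>) \<le> K0 * (real i + 1)" .
qed

text \<open>The real point \<open>(F ^^ n) t\<close> is put at time \<open>n\<close> and pulled back
  along \<open>s\<close>. By \<open>branch_near_real\<close> the errors do not accumulate, and the
  contraction makes the backward orbits \<open>y n\<close> converge, as \<open>n\<close> grows, at
  each time from \<open>k\<close> on.\<close>

lemma follows_exists:
  assumes large: "\<And>n. n \<ge> k \<Longrightarrow> (2 * K0 + 2) * (real n + 1) \<le> (F ^^ n) t"
  shows "\<exists>z\<in>itinerary_set lam s. \<forall>n\<ge>k. norm ((E lam ^^ n) z - of_real ((F ^^ n) t)) \<le> K0 * (real n + 1)"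
proof -
  define y where "y = (\<lambda>n i. pull lam (map s [i..<n]) (of_real ((F ^^ n) t)))"
  have y_step: "y n i = branch lam (s i) (y n (Suc i))" if "i < n" for n i
    using that by (simp add: y_def upt_conv_Cons)
  have near: "norm (branch lam (s i) w - of_real ((F ^^ i) t)) \<le> K0 * (real i + 1)"
    if "norm (w - of_real ((F ^^ Suc i) t)) \<le> K0 * (real (Suc i) + 1)" "k \<le> i" for w i
    using branch_near_real[of i "(F ^^ i) t" w] that large[of "Suc i"] by (simp_all add: add.commute)
  have y_near: "norm (y n i - of_real ((F ^^ i) t)) \<le> K0 * (real i + 1)" if "k \<le> i" "i \<le> n" for n i
    using that(2)
  proof (induction rule: inc_induct)
    case base
    show ?case using K0_ge_1 by (simp add: y_def)
  next
    case (step j)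
    then show ?case using near[of "y n (Suc j)" j] y_step[of j n] that by simp
  qed
  have Re2: "2 \<le> Re w" if "norm (w - of_real ((F ^^ i) t)) \<le> K0 * (real i + 1)" "k \<le> i" for w i
  proof -
    have "\<bar>Re w - (F ^^ i) t\<bar> \<le> K0 * (real i + 1)"
      using that(1) abs_Re_le_cmod[of "w - of_real ((F ^^ i) t)"] by simp
    moreover have "0 \<le> K0 * (real i + 1)" using K0_ge_1 by simp
    ultimately show ?thesis using large[OF that(2)] by (simp add: algebra_simps)
  qed
  have "Cauchy (\<lambda>n. y n i)" if i: "k \<le> i" for i
  proof (rule CauchyI')
    fix e :: real assume "e > 0"
    have "eventually (\<lambda>m. K0 * (real (i + m) + 1) / 2 ^ m < e) sequentially"
      using order_tendstoD(2)[OF linear_over_pow2_tendsto_0 \<open>e > 0\<close>] .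
    then obtain M where M: "\<And>m. m \<ge> M \<Longrightarrow> K0 * (real (i + m) + 1) / 2 ^ m < e"
      by (auto simp: eventually_sequentially)
    show "\<exists>M. \<forall>m\<ge>M. \<forall>n>m. dist (y m i) (y n i) < e"
    proof (intro exI[of _ "i + M"] allI impI)
      fix m n assume m: "i + M \<le> m" "m < n"
      have "norm (y m i - y n i) \<le> norm (y m m - y n m) / 2 ^ (m - i)"
      proof (rule backward_contraction[where s = s], goal_cases)
        case (2 j)
        then show ?case using m i by (intro conjI y_step Re2[OF y_near]) auto
      next
        case (3 j)
        then show ?case using m i by (intro conjI y_step Re2[OF y_near]) auto
      qed (use m in simp)
      also have "norm (y m m - y n m) \<le> K0 * (real m + 1)"
        using y_near[of m n] m i by (simp add: y_def norm_minus_commute)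
      also have "K0 * (real m + 1) / 2 ^ (m - i) < e" using M[of "m - i"] m by simp
      finally show "dist (y m i) (y n i) < e" by (simp add: dist_norm divide_right_mono)
    qed
  qed
  then have "\<forall>i. \<exists>l. k \<le> i \<longrightarrow> (\<lambda>n. y n i) \<longlonglongrightarrow> l"
    using Cauchy_convergent convergent_def by blast
  then obtain Y where Y: "\<And>i. k \<le> i \<Longrightarrow> (\<lambda>n. y n i) \<longlonglongrightarrow> Y i" by metis
  have Y_near: "norm (Y i - of_real ((F ^^ i) t)) \<le> K0 * (real i + 1)" if "k \<le> i" for i
  proof (rule LIMSEQ_le_const2)
    show "(\<lambda>n. norm (y n i - of_real ((F ^^ i) t))) \<longlonglongrightarrow> norm (Y i - of_real ((F ^^ i) t))"
      using Y[OF that] by (intro tendsto_intros)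
    show "\<exists>N. \<forall>n\<ge>N. norm (y n i - of_real ((F ^^ i) t)) \<le> K0 * (real i + 1)"
      using y_near[OF that] by blast
  qed
  have Y_nz: "Y i \<noteq> 0" "Y i / of_real lam \<notin> \<real>\<^sub>\<le>\<^sub>0" if "k \<le> i" for i
    using Re2[OF Y_near[OF that] that] lam_pos
    by (auto simp: complex_nonpos_Reals_iff divide_le_0_iff)
  \<comment> \<open>Strips are not closed, so membership does not survive the limit by itself. It is
    recovered from \<open>Y i\<close> being a value of the branch, which is continuous at
    \<open>Y (Suc i)\<close> because the real part there is at least \<open>2\<close>.\<close>
  have Y_step: "Y i = branch lam (s i) (Y (Suc i))" if "k \<le> i" for i
  proof (rule LIMSEQ_unique[OF Y[OF that]])
    have "(\<lambda>n. branch lam (s i) (y n (Suc i))) \<longlonglongrightarrow> branch lam (s i) (Y (Suc i))"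
      using isCont_tendsto_compose[OF isCont_branch Y[of "Suc i"]] Y_nz[of "Suc i"] that by simp
    then show "(\<lambda>n. y n i) \<longlonglongrightarrow> branch lam (s i) (Y (Suc i))"
      by (rule Lim_transform_eventually)
        (use y_step in \<open>auto simp: eventually_sequentially intro!: exI[of _ "Suc i"]\<close>)
  qed
  have Y_strip: "Y i \<in> strip (s i)" if "k \<le> i" for i
    using branch_in_strip[of "Y (Suc i)" "s i"] Y_step[OF that] Y_nz[of "Suc i"] that by simp
  have Y_pull: "Y k = pull lam (map s [k..<k + m]) (Y (k + m))" for m
  proof (induction m)
    case (Suc m)
    then show ?case using Y_step[of "k + m"] by simp
  qed simp
  have nr: "Im (Y k) \<noteq> 0"
  proof -
    obtain m where m: "m \<ge> k" "s m \<noteq> 0" using nonzero by blast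
    then have "Im (Y m) \<noteq> 0" using Y_strip strip_Im_nonzero by blast
    then show ?thesis using Y_pull[of "m - k"] m pull_Im_nonzero[of "Y m"] by simp
  qed
  define z where "z = pull lam (map s [0..<k]) (Y k)"
  have zk: "(E lam ^^ (k + j)) z = Y (k + j)" for j
  proof (induction j)
    case 0
    show ?case using E_iter_pull[OF nr, of k "map s [0..<k]"] by (simp add: z_def)
  next
    case (Suc j)
    then show ?case using E_branch[of "Y (Suc (k + j))" "s (k + j)"] Y_nz[of "Suc (k + j)"] Y_step[of "k + j"]
      by simp
  qed
  have "(E lam ^^ j) z \<in> strip (s j)" for j
  proof (cases "j < k")
    case True
    then show ?thesis using pull_in_strip[OF nr, of j "map s [0..<k]"] by (simp add: z_def)
  next
    case False
    then show ?thesis using zk[of "j - k"] Y_strip[of j] by simp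
  qed
  then have "z \<in> itinerary_set lam s" by (simp add: itinerary_set_def)
  moreover have "norm ((E lam ^^ n) z - of_real ((F ^^ n) t)) \<le> K0 * (real n + 1)" if "n \<ge> k" for n
    using zk[of "n - k"] Y_near[OF that] that by simp
  ultimately show ?thesis by blast
qed

section \<open>The parametrization of the escaping points by potential\<close>

definition \<psi> :: "real \<Rightarrow> complex" where
  "\<psi> t = (THE z. follows t z)"

text \<open>In \<open>follows\<close> the constants may depend on the point. Here the error constant
  is \<open>K0\<close> for every \<open>t\<close>, and the starting time is read off from the orbit
  of \<open>F\<close>; continuity and the limit at infinity rest on this uniformity.\<close>

lemma \<psi>_near:
  assumes "t > 0" "\<And>n. n \<ge> k \<Longrightarrow> (2 * K0 + 2) * (real n + 1) \<le> (F ^^ n) t"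
  shows "follows t (\<psi> t)" "\<And>n. n \<ge> k \<Longrightarrow> norm ((E lam ^^ n) (\<psi> t) - of_real ((F ^^ n) t)) \<le> K0 * (real n + 1)"
proof -
  obtain z where z: "z \<in> itinerary_set lam s"
    "\<And>n. n \<ge> k \<Longrightarrow> norm ((E lam ^^ n) z - of_real ((F ^^ n) t)) \<le> K0 * (real n + 1)"
    using follows_exists[OF assms(2)] by blast
  then have f: "follows t z" by (auto simp: follows_def)
  then have "\<psi> t = z" unfolding \<psi>_def using follows_unique[OF assms(1)] by blast
  then show "follows t (\<psi> t)" "\<And>n. n \<ge> k \<Longrightarrow> norm ((E lam ^^ n) (\<psi> t) - of_real ((F ^^ n) t)) \<le> K0 * (real n + 1)"
    using z f by auto
qed

lemma follows_\<psi>: "t > 0 \<Longrightarrow> follows t (\<psi> t)"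
  using F_iter_superlinear[of t "2 * K0 + 2"] \<psi>_near(1) by blast

lemma follows_escaping:
  assumes "t > 0" "follows t z"
  shows "z \<in> escaping_set lam s"
proof -
  obtain k where k: "\<And>n. n \<ge> k \<Longrightarrow> real n + 2 \<le> Re ((E lam ^^ n) z)"
    using follows_Re_large[OF assms] by blast
  have "filterlim (\<lambda>n. norm ((E lam ^^ n) z)) at_top sequentially"
  proof (rule filterlim_at_top_mono[OF filterlim_real_sequentially])
    show "eventually (\<lambda>n. real n \<le> norm ((E lam ^^ n) z)) sequentially"
      unfolding eventually_sequentially
      using k complex_Re_le_cmod by (intro exI[of _ k]) (smt (verit))
  qed
  then have "filterlim (\<lambda>n. (E lam ^^ n) z) at_infinity sequentially"
    using filterlim_at_infinity_conv_norm_at_top by blast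
  then show ?thesis using assms by (simp add: escaping_set_def follows_def)
qed

text \<open>At time \<open>k + m\<close> the two orbits differ by a linear term plus the gap of two
  orbits of \<open>F\<close>. Division by \<open>2 ^ m\<close> makes the linear term small by the
  choice of \<open>m\<close>; for this \<open>m\<close> the gap is small when \<open>t\<close> is
  close to \<open>t0\<close>. Continuity of the finite pullback moves the result from time
  \<open>k\<close> to time \<open>0\<close>.\<close>

lemma continuous_\<psi>: "t0 > 0 \<Longrightarrow> isCont \<psi> t0"
proof -
  assume t0: "t0 > 0"
  define t1 where "t1 = t0 / 2"
  have t1: "t1 > 0" "t1 < t0" using t0 by (auto simp: t1_def)
  obtain k where k: "\<And>n. n \<ge> k \<Longrightarrow> (2 * K0 + 2) * (real n + 1) \<le> (F ^^ n) t1"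
    using F_iter_superlinear[OF t1(1)] by blast
  have kt: "(2 * K0 + 2) * (real n + 1) \<le> (F ^^ n) t" if "t > t1" "n \<ge> k" for t n
    using k[OF that(2)] F_iter_mono[of t1 t n] that by linarith
  have near: "norm ((E lam ^^ n) (\<psi> t) - of_real ((F ^^ n) t)) \<le> K0 * (real n + 1)" 
    "2 \<le> Re ((E lam ^^ n) (\<psi> t))" "\<psi> t \<in> itinerary_set lam s"
    if "t > t1" "n \<ge> k" for t n
  proof -
    show *: "norm ((E lam ^^ n) (\<psi> t) - of_real ((F ^^ n) t)) \<le> K0 * (real n + 1)"
      using \<psi>_near(2)[of t k n] kt that t1 by auto
    have "\<bar>Re ((E lam ^^ n) (\<psi> t)) - (F ^^ n) t\<bar> \<le> K0 * (real n + 1)"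
      using * abs_Re_le_cmod[of "(E lam ^^ n) (\<psi> t) - of_real ((F ^^ n) t)"] by simp
    moreover have "0 \<le> K0 * (real n + 1)" using K0_ge_1 by simp
    ultimately show "2 \<le> Re ((E lam ^^ n) (\<psi> t))" using kt[OF that] by (simp add: algebra_simps)
    show "\<psi> t \<in> itinerary_set lam s" using follows_\<psi>[of t] that t1 by (simp add: follows_def)
  qed
  have "((\<lambda>t. (E lam ^^ k) (\<psi> t)) \<longlongrightarrow> (E lam ^^ k) (\<psi> t0)) (at t0)"
  proof (rule tendstoI)
    fix e :: real assume e: "e > 0"
    have "eventually (\<lambda>m. 2 * K0 * (real (k + m) + 1) / 2 ^ m < e / 2) sequentially"
      by (rule order_tendstoD(2)[OF linear_over_pow2_tendsto_0]) (use e in simp)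
    then obtain m where m: "2 * K0 * (real (k + m) + 1) / 2 ^ m < e / 2"
      by (meson eventually_sequentially order_refl)
    have "((F ^^ (k + m)) \<longlongrightarrow> (F ^^ (k + m)) t0) (at t0)"
      using continuous_F_iter by (simp add: isCont_def)
    then have "eventually (\<lambda>t. dist ((F ^^ (k + m)) t) ((F ^^ (k + m)) t0) < e / 2) (at t0)"
      using e by (intro tendstoD) auto
    moreover have "eventually (\<lambda>t. t > t1) (at t0)"
      using order_tendstoD(1)[OF tendsto_ident_at t1(2), of UNIV] by simp
    ultimately show "eventually (\<lambda>t. dist ((E lam ^^ k) (\<psi> t)) ((E lam ^^ k) (\<psi> t0)) < e) (at t0)"
    proof eventually_elim
      case (elim t)
      let ?n = "k + m"
      have "norm ((E lam ^^ k) (\<psi> t) - (E lam ^^ k) (\<psi> t0))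
        \<le> norm ((E lam ^^ ?n) (\<psi> t) - (E lam ^^ ?n) (\<psi> t0)) / 2 ^ m"
        using near(2,3) elim(2) t1 by (intro orbit_contraction) blast+
      also have "norm ((E lam ^^ ?n) (\<psi> t) - (E lam ^^ ?n) (\<psi> t0))
        \<le> 2 * K0 * (real ?n + 1) + dist ((F ^^ ?n) t) ((F ^^ ?n) t0)"
      proof -
        let ?a = "(E lam ^^ ?n) (\<psi> t) - of_real ((F ^^ ?n) t)" 
        let ?b = "(E lam ^^ ?n) (\<psi> t0) - of_real ((F ^^ ?n) t0)"
        let ?c = "of_real ((F ^^ ?n) t - (F ^^ ?n) t0) :: complex"
        have "norm (?a - ?b + ?c) \<le> norm ?a + norm ?b + norm ?c"
          using norm_triangle_ineq[of "?a - ?b" ?c] norm_triangle_ineq4[of ?a ?b] by linarith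
        moreover have "?a - ?b + ?c = (E lam ^^ ?n) (\<psi> t) - (E lam ^^ ?n) (\<psi> t0)" by simp
        moreover have "norm ?c = dist ((F ^^ ?n) t) ((F ^^ ?n) t0)" by (simp only: norm_of_real dist_real_def)
        ultimately show ?thesis using near(1)[of t ?n] near(1)[of t0 ?n] elim t1 by simp
      qed
      also have "(2 * K0 * (real ?n + 1) + dist ((F ^^ ?n) t) ((F ^^ ?n) t0)) / 2 ^ m < e"
      proof -
        have "dist ((F ^^ ?n) t) ((F ^^ ?n) t0) / 2 ^ m \<le> dist ((F ^^ ?n) t) ((F ^^ ?n) t0) / 1"
          by (intro divide_left_mono) auto
        then show ?thesis using m elim(1) by (simp add: add_divide_distrib)
      qed
      finally show ?case by (simp add: dist_norm divide_right_mono)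
    qed
  qed
  moreover have "isCont (pull lam (map s [0..<k])) ((E lam ^^ k) (\<psi> t0))"
    using near(3)[of t0 k] t1 by (intro isCont_pull orbit_Im_nonzero) auto
  ultimately have "((\<lambda>t. pull lam (map s [0..<k]) ((E lam ^^ k) (\<psi> t))) \<longlongrightarrow>
      pull lam (map s [0..<k]) ((E lam ^^ k) (\<psi> t0))) (at t0)"
    by (rule isCont_tendsto_compose[rotated])
  moreover have "pull lam (map s [0..<k]) ((E lam ^^ k) (\<psi> t0)) = \<psi> t0"
    using t1 by (intro orbit_pull_0 near(3)) auto
  moreover have "eventually (\<lambda>t. pull lam (map s [0..<k]) ((E lam ^^ k) (\<psi> t)) = \<psi> t) (at t0)"
  proof -
    have "eventually (\<lambda>t. t > t1) (at t0)"
      using order_tendstoD(1)[OF tendsto_ident_at t1(2), of UNIV] by simp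
    then show ?thesis
      by eventually_elim (intro orbit_pull_0 near(3), auto)
  qed
  ultimately show "isCont \<psi> t0"
    unfolding isCont_def using Lim_transform_eventually by fastforce
qed

lemma \<psi>_at_infinity: "filterlim \<psi> at_infinity at_top"
proof -
  have "filterlim (\<lambda>t. norm (\<psi> t)) at_top at_top"
  proof (rule filterlim_at_top_mono)
    show "filterlim (\<lambda>t::real. t - K0) at_top at_top" by real_asymp
    have "t - K0 \<le> norm (\<psi> t)" if "t \<ge> 2 * K0 + 2" for t
    proof -
      have "norm ((E lam ^^ 0) (\<psi> t) - of_real ((F ^^ 0) t)) \<le> K0 * (real 0 + 1)"
        by (rule \<psi>_near(2)[where k = 0]) (use that K0_ge_1 F_iter_large[of "2 * K0 + 2" t] in auto)
      then have "\<bar>Re (\<psi> t) - t\<bar> \<le> K0" using abs_Re_le_cmod[of "\<psi> t - of_real t"] by simp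
      then show ?thesis using complex_Re_le_cmod[of "\<psi> t"] by linarith
    qed
    then show "eventually (\<lambda>t. t - K0 \<le> norm (\<psi> t)) at_top"
      by (auto simp: eventually_at_top_linorder)
  qed
  then show ?thesis using filterlim_at_infinity_conv_norm_at_top by blast
qed

end

section \<open>The hair is the escaping set\<close>

text \<open>\<open>F\<close> maps each interval \<open>[r n - C, r n + C]\<close> over the next one, so the pullbacks are nested.\<close>
lemma exists_F_orbit_in_intervals:
  assumes pos: "\<And>n. 0 < r n - C" and C: "0 \<le> C"
    and lo: "\<And>n. F (r n - C) \<le> r (Suc n) - C"
    and hi: "\<And>n. r (Suc n) + C \<le> F (r n + C)"
  shows "\<exists>t>0. \<forall>n. \<bar>(F ^^ n) t - r n\<bar> \<le> C"
proof -
  define G where "G = (\<lambda>x::real. ln (1 + x))"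
  have GF: "G (F x) = x" for x by (simp add: G_def F_def)
  have FG: "F (G x) = x" if "0 < x" for x using that by (simp add: G_def F_def)
  have G_pos: "0 < G x" if "0 < x" for x using that by (simp add: G_def)
  have G_mono: "G x \<le> G y" if "0 < x" "x \<le> y" for x y using that by (simp add: G_def)
  have Gn_pos: "0 < (G ^^ n) x" if "0 < x" for n x using that by (induction n) (auto intro: G_pos)
  have Gn_mono: "(G ^^ n) x \<le> (G ^^ n) y" if "0 < x" "x \<le> y" for n x y
    using that by (induction n) (auto intro!: G_mono Gn_pos)
  have FGn: "(F ^^ n) ((G ^^ n) x) = x" if "0 < x" for n x using that
  proof (induction n arbitrary: x)
    case (Suc n)
    have "(F ^^ Suc n) ((G ^^ Suc n) x) = F ((F ^^ n) ((G ^^ n) (G x)))" by (simp add: funpow_swap1)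
    then show ?case using Suc G_pos FG by simp
  qed simp
  define a where "a = (\<lambda>n. (G ^^ n) (r n - C))"
  define b where "b = (\<lambda>n. (G ^^ n) (r n + C))"
  have posb: "0 < r n + C" for n using pos[of n] C by linarith
  have a_le_b: "a n \<le> b n" for n unfolding a_def b_def using pos C by (intro Gn_mono) auto
  have "a n \<le> a (Suc n)" for n
  proof -
    have F_pos: "0 < F (r n - C)" using pos[of n] by (simp add: F_def)
    have "r n - C \<le> G (r (Suc n) - C)" using G_mono[OF F_pos lo[of n]] by (simp add: GF)
    then show ?thesis using Gn_mono[OF pos] by (simp add: a_def funpow_swap1)
  qed
  then have "incseq a" by (rule incseq_SucI)
  have "b (Suc n) \<le> b n" for n
  proof -
    have "G (r (Suc n) + C) \<le> r n + C" using G_mono[OF posb hi[of n]] by (simp add: GF)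
    then show ?thesis using Gn_mono[OF G_pos[OF posb]] by (simp add: b_def funpow_swap1)
  qed
  then have "decseq b" by (rule decseq_SucI)
  have ab: "a m \<le> b n" for m n
    using incseqD[OF \<open>incseq a\<close>, of m "max m n"] decseqD[OF \<open>decseq b\<close>, of n "max m n"] a_le_b[of "max m n"]
    by simp
  define t where "t = (SUP n. a n)"
  have at: "a n \<le> t" for n unfolding t_def using ab[of _ 0] by (intro cSUP_upper bdd_aboveI2) auto
  have tb: "t \<le> b n" for n unfolding t_def using ab by (intro cSUP_least) auto
  have "\<bar>(F ^^ n) t - r n\<bar> \<le> C" for n
  proof -
    have "(F ^^ n) (a n) \<le> (F ^^ n) t" "(F ^^ n) t \<le> (F ^^ n) (b n)"
      using at tb by (auto intro: F_iter_mono)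
    then show ?thesis using FGn[OF pos] FGn[OF posb] by (simp add: a_def b_def abs_le_iff algebra_simps)
  qed
  moreover have "t > 0" using at[of 0] pos[of 0] by (simp add: a_def)
  ultimately show ?thesis by blast
qed

lemma F_iter_surj:
  assumes "t > 0"
  shows "\<exists>t'>0. (F ^^ k) t' = t"
proof (induction k)
  case 0
  then show ?case using assms by auto
next
  case (Suc k)
  then obtain t' where "t' > 0" "(F ^^ k) t' = t" by blast
  moreover have "F (ln (1 + t')) = t'" "0 < ln (1 + t')" using \<open>t' > 0\<close> by (simp_all add: F_def)
  ultimately show ?case by (intro exI[of _ "ln (1 + t')"]) (simp add: funpow_swap1)
qed

text \<open>Composing with the inverse of the closed ray would give a continuous injection of
  \<open>{0<..}\<close> onto \<open>{0..}\<close>; it is strictly monotone, so its image has no least element.\<close>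
lemma closed_ray_not_open_ray:
  fixes f g :: "real \<Rightarrow> complex"
  assumes f: "continuous_on {0<..} f" "inj_on f {0<..}"
    and g: "continuous_on {0..} g" "inj_on g {0..}" "filterlim g at_infinity at_top"
    and eq: "f ` {0<..} = g ` {0..}"
  shows False
proof -
  define h where "h = (\<lambda>x. the_inv_into {0..} g (f x))"
  have fin: "f x \<in> g ` {0..}" if "x > 0" for x using eq that by auto
  have gh: "g (h x) = f x" if "x > 0" for x
    unfolding h_def by (rule f_the_inv_into_f[OF g(2) fin[OF that]])
  have h0: "h x \<ge> 0" if "x > 0" for x
    using the_inv_into_into[OF g(2) fin[OF that] subset_refl] by (simp add: h_def)
  have h_inj: "x = y" if "x > 0" "y > 0" "h x = h y" for x y
    using gh[OF that(1)] gh[OF that(2)] that f(2) by (auto dest: inj_onD)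
  have h_onto: "\<exists>x>0. h x = y" if "y \<ge> 0" for y
  proof -
    have "g y \<in> f ` {0<..}" using eq that by auto
    then obtain x where "x > 0" "f x = g y" by auto
    then have "h x = y" using g(2) gh[of x] h0[of x] that by (auto dest: inj_onD)
    with \<open>x > 0\<close> show ?thesis by blast
  qed
  \<comment> \<open>The inverse of \<open>g\<close> is continuous on images of compact intervals. As
    \<open>g\<close> tends to infinity and \<open>f\<close> is bounded on \<open>{a..b}\<close>, the
    values of \<open>h\<close> there stay in such an interval.\<close>
  have h_cont: "continuous_on {a..b} h" if ab: "0 < a" "a \<le> b" for a b
  proof -
    have fc: "continuous_on {a..b} f" using f(1) ab by (auto intro: continuous_on_subset)
    have "bounded (f ` {a..b})" using compact_continuous_image[OF fc] by (simp add: compact_imp_bounded)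
    then obtain B where B: "\<And>x. x \<in> {a..b} \<Longrightarrow> norm (f x) \<le> B" unfolding bounded_iff by blast
    have "eventually (\<lambda>y. B + 1 \<le> norm (g y)) at_top"
      using g(3) by (auto simp: filterlim_at_infinity_conv_norm_at_top filterlim_at_top)
    then obtain N where N: "\<And>y. y \<ge> N \<Longrightarrow> B + 1 \<le> norm (g y)" by (auto simp: eventually_at_top_linorder)
    define N' where "N' = max N 0"
    have hN: "h x \<in> {0..N'}" if "x \<in> {a..b}" for x
    proof -
      have "x > 0" using that ab by auto
      moreover have "\<not> h x \<ge> N" using N[of "h x"] gh[OF \<open>x > 0\<close>] B[OF that] by auto
      ultimately show ?thesis using h0 by (auto simp: N'_def)
    qed
    have gc: "continuous_on {0..N'} g" and gi: "inj_on g {0..N'}"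
      using g(1,2) by (auto intro: continuous_on_subset inj_on_subset)
    have inv: "continuous_on (g ` {0..N'}) (the_inv_into {0..N'} g)"
      using continuous_on_inv_into[OF gc _ gi] by auto
    have "continuous_on {a..b} (\<lambda>x. the_inv_into {0..N'} g (f x))"
    proof (rule continuous_on_compose2[OF inv fc])
      show "f ` {a..b} \<subseteq> g ` {0..N'}"
      proof
        fix w assume "w \<in> f ` {a..b}"
        then obtain x where x: "x \<in> {a..b}" "w = f x" by blast
        then have "w = g (h x)" using gh[of x] ab by simp
        then show "w \<in> g ` {0..N'}" using hN[OF x(1)] by blast
      qed
    qed
    moreover have "the_inv_into {0..N'} g (f x) = h x" if "x \<in> {a..b}" for x
      using the_inv_into_f_eq[OF gi gh hN[OF that]] that ab by auto
    ultimately show ?thesis by (rule continuous_on_eq)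
  qed
  obtain x0 where x0: "x0 > 0" "h x0 = 0" using h_onto[of 0] by auto
  let ?a = "x0 / 2" and ?b = "2 * x0"
  have "h ?a > 0" "h ?b > 0"
    using h0[of ?a] h0[of ?b] h_inj[of ?a x0] h_inj[of ?b x0] x0 by (auto simp: less_le)
  define m where "m = min (h ?a) (h ?b) / 2"
  have m: "0 < m" "m < h ?a" "m < h ?b" using \<open>h ?a > 0\<close> \<open>h ?b > 0\<close> by (auto simp: m_def)
  obtain x1 where x1: "?a \<le> x1" "x1 \<le> x0" "h x1 = m"
    using IVT2'[of h x0 m ?a] h_cont[of ?a x0] x0 m by auto
  obtain x2 where x2: "x0 \<le> x2" "x2 \<le> ?b" "h x2 = m"
    using IVT'[of h x0 m ?b] h_cont[of x0 ?b] x0 m by auto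
  have "x1 = x2" using h_inj[of x1 x2] x1 x2 x0 by auto
  then have "x1 = x0" using x1 x2 by simp
  then show False using x0 x1 m by simp
qed

context slow_itinerary
begin

lemma escaping_Re_at_top:
  assumes "z \<in> escaping_set lam s"
  shows "filterlim (\<lambda>n. Re ((E lam ^^ n) z)) at_top sequentially"
  unfolding filterlim_at_top
proof
  fix M :: real
  have "filterlim (\<lambda>n. norm ((E lam ^^ n) z)) at_top sequentially"
    using assms by (simp add: escaping_set_def filterlim_at_infinity_conv_norm_at_top)
  then have "eventually (\<lambda>n. lam * exp M \<le> norm ((E lam ^^ Suc n) z)) sequentially"
    by (subst eventually_sequentially_Suc) (simp add: filterlim_at_top)
  then show "eventually (\<lambda>n. M \<le> Re ((E lam ^^ n) z)) sequentially"
    by eventually_elim (use lam_pos in \<open>simp add: norm_E\<close>)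
qed

lemma Re_orbit_Suc_ge:
  assumes "z \<in> itinerary_set lam s" "0 \<le> Re ((E lam ^^ Suc n) z)"
  shows "lam * exp (Re ((E lam ^^ n) z)) - (2 * \<bar>real_of_int (s (Suc n))\<bar> + 1) * pi \<le> Re ((E lam ^^ Suc n) z)"
proof -
  have "norm ((E lam ^^ Suc n) z) = lam * exp (Re ((E lam ^^ n) z))" by (simp add: norm_E)
  moreover have "norm ((E lam ^^ Suc n) z) \<le> Re ((E lam ^^ Suc n) z) + \<bar>Im ((E lam ^^ Suc n) z)\<bar>"
    using cmod_le[of "(E lam ^^ Suc n) z"] assms(2) by linarith
  moreover have "\<bar>Im ((E lam ^^ Suc n) z)\<bar> \<le> (2 * \<bar>real_of_int (s (Suc n))\<bar> + 1) * pi"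
    using assms(1) unfolding itinerary_set_def by (intro abs_Im_strip) blast
  ultimately show ?thesis by linarith
qed

text \<open>In a zero block the real part at least doubles at every step; after a block whose length is at least its
  starting index it exceeds the index, and from then on the entries of \<open>s\<close> are too small to matter.\<close>
lemma escaping_Re_linear:
  assumes "z \<in> escaping_set lam s"
  shows "eventually (\<lambda>n. real n + 1 \<le> Re ((E lam ^^ n) z)) sequentially"
proof -
  have zI: "z \<in> itinerary_set lam s" using assms by (simp add: escaping_set_def)
  define r where "r = (\<lambda>n. Re ((E lam ^^ n) z))"
  \<comment> \<open>The term \<open>(2 * x + 1) * pi\<close> bounds the imaginary part in a strip of
    index at most \<open>x\<close>. It will absorb the entry of \<open>s\<close> at time
    \<open>n + 1\<close>, whose size is at most \<open>n + 1 \<le> r n\<close>.\<close>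
  have "eventually (\<lambda>x. 2 \<le> x \<and> (2 * x + 1) * pi + 2 * x + 1 \<le> lam * exp x) at_top"
    using lam_pos by (intro eventually_conj eventually_ge_at_top) real_asymp
  then have "eventually (\<lambda>n. 2 \<le> r n \<and> (2 * r n + 1) * pi + 2 * r n + 1 \<le> lam * exp (r n)) sequentially"
    unfolding r_def by (rule eventually_compose_filterlim[OF _ escaping_Re_at_top[OF assms]])
  then obtain n0 where n0: "\<And>n. n \<ge> n0 \<Longrightarrow> 2 \<le> r n \<and> (2 * r n + 1) * pi + 2 * r n + 1 \<le> lam * exp (r n)"
    by (auto simp: eventually_sequentially)
  obtain a N where aN: "a \<ge> n0" "N \<ge> a" "1 \<le> N" "\<And>i. a \<le> i \<Longrightarrow> i < a + N \<Longrightarrow> s i = 0"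
    using long_runs[of n0] by blast
  have dbl: "2 ^ Suc i \<le> r (a + i)" if "i < N" for i
    using that
  proof (induction i)
    case 0
    then show ?case using n0[of a] aN by simp
  next
    case (Suc i)
    have "lam * exp (r (a + i)) - (2 * \<bar>real_of_int (s (Suc (a + i)))\<bar> + 1) * pi \<le> r (Suc (a + i))"
      unfolding r_def using n0[of "Suc (a + i)"] aN by (intro Re_orbit_Suc_ge[OF zI]) (auto simp: r_def)
    moreover have "s (Suc (a + i)) = 0" using aN Suc by simp
    moreover have "0 \<le> r (a + i) * pi" 
      "(2 * r (a + i) + 1) * pi + 2 * r (a + i) + 1 \<le> lam * exp (r (a + i))"
      using n0[of "a + i"] aN by auto
    ultimately have "2 * r (a + i) \<le> r (Suc (a + i))" by (simp add: algebra_simps)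
    then show ?case using Suc by simp
  qed
  \<comment> \<open>The last time of the zero run. There the real part is at least
    \<open>2 ^ N\<close>, and \<open>2 ^ N \<ge> 2 * N \<ge> a + N = b + 1\<close> because
    \<open>N \<ge> a\<close>.\<close>
  define b where "b = a + (N - 1)"
  have b: "real b + 1 \<le> r b"
  proof -
    have "real N \<le> 2 ^ (N - 1)" using aN(3)
    proof (induction N rule: dec_induct)
      case (step n)
      have "real (Suc n) \<le> 2 * real n" using step by simp
      also have "\<dots> \<le> 2 * 2 ^ (n - 1)" using step.IH by (rule mult_left_mono) simp
      also have "\<dots> = 2 ^ (Suc n - 1)" using step by (cases n) auto
      finally show ?case .
    qed simp
    then have "2 * real N \<le> 2 ^ Suc (N - 1)" by simp
    also have "\<dots> \<le> r b" using dbl[of "N - 1"] aN by (simp add: b_def)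
    finally show ?thesis using aN by (simp add: b_def of_nat_diff)
  qed
  have "real n + 1 \<le> r n" if "n \<ge> b" for n
    using that
  proof (induction n rule: dec_induct)
    case base
    show ?case using b .
  next
    case (step n)
    have nn: "n \<ge> n0" using step aN by (simp add: b_def)
    have "lam * exp (r n) - (2 * \<bar>real_of_int (s (Suc n))\<bar> + 1) * pi \<le> r (Suc n)"
      unfolding r_def using n0[of "Suc n"] nn by (intro Re_orbit_Suc_ge[OF zI]) (auto simp: r_def)
    moreover have "(2 * \<bar>real_of_int (s (Suc n))\<bar> + 1) * pi \<le> (2 * r n + 1) * pi"
      using slow_real[of "Suc n"] step by (intro mult_right_mono) auto
    moreover have "(2 * r n + 1) * pi + 2 * r n + 1 \<le> lam * exp (r n)" "2 \<le> r n" using n0[OF nn] by auto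
    ultimately have "2 * r n + 1 \<le> r (Suc n)" by linarith
    then show ?case using step.IH \<open>2 \<le> r n\<close> by simp
  qed
  then show ?thesis unfolding r_def eventually_sequentially by blast
qed

text \<open>From some time \<open>k\<close> on the real parts behave like an orbit of
  \<open>F\<close>, up to the factor \<open>lam\<close> and an error from the imaginary part that is
  small against the exponential. A bounded shift \<open>C\<close> absorbs both, and
  \<open>F_iter_surj\<close> moves the start of the shadowing orbit from time \<open>k\<close> to
  time \<open>0\<close>.\<close>

lemma escaping_follows:
  assumes "z \<in> escaping_set lam s"
  shows "\<exists>t>0. follows t z"
proof -
  have zI: "z \<in> itinerary_set lam s" using assms by (simp add: escaping_set_def)
  \<comment> \<open>\<open>exp C \<ge> lam + 1\<close> serves the upper ends of the intervals and
    \<open>exp C \<ge> 2 / lam\<close> the lower ends; in both cases the surplus over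
    \<open>lam\<close> takes up the additive terms.\<close>
  define C where "C = max (ln (lam + 1)) (max (ln (2 / lam)) 1)"
  have C: "1 \<le> C" "lam + 1 \<le> exp C" "2 / lam \<le> exp C"
  proof -
    show "1 \<le> C" by (simp add: C_def)
    have "exp (ln (lam + 1)) \<le> exp C" "exp (ln (2 / lam)) \<le> exp C" unfolding exp_le_cancel_iff by (auto simp: C_def)
    then show "lam + 1 \<le> exp C" "2 / lam \<le> exp C" using lam_pos by auto
  qed
  have C': "exp (- C) \<le> lam / 2" using C(3) lam_pos by (simp add: exp_minus field_simps)
  define r where "r = (\<lambda>n. Re ((E lam ^^ n) z))"
  have "eventually (\<lambda>x. C + 1 \<le> x \<and> (2 * x + 1) * pi + C \<le> lam * exp x / 2) at_top"
    using lam_pos by (intro eventually_conj eventually_ge_at_top) real_asymp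
  then have "eventually (\<lambda>n. C + 1 \<le> r n \<and> (2 * r n + 1) * pi + C \<le> lam * exp (r n) / 2) sequentially"
    unfolding r_def by (rule eventually_compose_filterlim[OF _ escaping_Re_at_top[OF assms]])
  moreover have "eventually (\<lambda>n. real n + 1 \<le> r n) sequentially"
    using escaping_Re_linear[OF assms] by (simp add: r_def)
  ultimately have "eventually (\<lambda>n. (C + 1 \<le> r n \<and> (2 * r n + 1) * pi + C \<le> lam * exp (r n) / 2) \<and>
      real n + 1 \<le> r n) sequentially"
    by (rule eventually_conj)
  then obtain k where k: "\<And>n. n \<ge> k \<Longrightarrow> C + 1 \<le> r n" "\<And>n. n \<ge> k \<Longrightarrow> (2 * r n + 1) * pi + C \<le> lam * exp (r n) / 2"
      "\<And>n. n \<ge> k \<Longrightarrow> real n + 1 \<le> r n"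
    unfolding eventually_sequentially by blast
  have "\<exists>t>0. \<forall>n. \<bar>(F ^^ n) t - r (k + n)\<bar> \<le> C"
  proof (rule exists_F_orbit_in_intervals)
    fix n
    have kn: "k \<le> k + n" "k \<le> Suc (k + n)" by auto
    have fold_upper: "r (Suc (k + n)) \<le> lam * exp (r (k + n))"
      using complex_Re_le_cmod[of "(E lam ^^ Suc (k + n)) z"] by (simp add: norm_E r_def)
    have "lam * exp (r (k + n)) - (2 * \<bar>real_of_int (s (Suc (k + n)))\<bar> + 1) * pi \<le> r (Suc (k + n))"
      unfolding r_def using k(1)[OF kn(2)] C(1) by (intro Re_orbit_Suc_ge[OF zI]) (auto simp: r_def)
    moreover have "(2 * \<bar>real_of_int (s (Suc (k + n)))\<bar> + 1) * pi \<le> (2 * r (k + n) + 1) * pi"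
      using slow_real[of "Suc (k + n)"] k(3)[OF kn(1)] by (intro mult_right_mono) auto
    ultimately have lo: "lam * exp (r (k + n)) / 2 + C \<le> r (Suc (k + n))" using k(2)[OF kn(1)] by linarith
    have "exp (r (k + n) - C) \<le> lam / 2 * exp (r (k + n))"
      using mult_right_mono[OF C', of "exp (r (k + n))"] by (simp add: exp_diff exp_minus field_simps)
    then show "F (r (k + n) - C) \<le> r (k + Suc n) - C" using lo by (simp add: F_def)
    have "(lam + 1) * exp (r (k + n)) \<le> exp (r (k + n) + C)"
      using mult_right_mono[OF C(2), of "exp (r (k + n))"] by (simp add: exp_add mult.commute)
    moreover have "C + 1 \<le> exp (r (k + n))" using exp_ge_add_one_self[of "r (k + n)"] k(1)[OF kn(1)] by linarith
    ultimately show "r (k + Suc n) + C \<le> F (r (k + n) + C)" using fold_upper by (simp add: F_def algebra_simps)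
    show "0 < r (k + n) - C" using k(1)[OF kn(1)] by simp
    show "0 \<le> C" using C by simp
  qed
  then obtain t' where t': "t' > 0" "\<And>n. \<bar>(F ^^ n) t' - r (k + n)\<bar> \<le> C" by blast
  obtain t where t: "t > 0" "(F ^^ k) t = t'" using F_iter_surj[OF t'(1)] by blast
  have "norm ((E lam ^^ n) z - of_real ((F ^^ n) t)) \<le> (C + 2 * pi) * (real n + 1)" if "n \<ge> k" for n
  proof -
    have "(F ^^ n) t = (F ^^ (n - k)) t'" using t that by (metis comp_apply funpow_add le_add_diff_inverse2)
    then have "\<bar>(F ^^ n) t - r n\<bar> \<le> C" using t'(2)[of "n - k"] that by simp
    then have "\<bar>Re ((E lam ^^ n) z - of_real ((F ^^ n) t))\<bar> \<le> C" by (simp add: r_def abs_minus_commute)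
    moreover have "\<bar>Im ((E lam ^^ n) z - of_real ((F ^^ n) t))\<bar> \<le> (2 * real n + 1) * pi"
      using abs_Im_orbit[OF zI, of n] by simp
    ultimately have "norm ((E lam ^^ n) z - of_real ((F ^^ n) t)) \<le> C + (2 * real n + 1) * pi"
      using cmod_le[of "(E lam ^^ n) z - of_real ((F ^^ n) t)"] by linarith
    also have "\<dots> \<le> (C + 2 * pi) * (real n + 1)" using C(1) pi_gt_zero by (simp add: algebra_simps)
    finally show ?thesis .
  qed
  then have "follows t z" using zI unfolding follows_def by blast
  with t show ?thesis by blast
qed

lemma \<psi>_image: "\<psi> ` {0<..} = escaping_set lam s"
proof
  show "\<psi> ` {0<..} \<subseteq> escaping_set lam s" using follows_\<psi> follows_escaping by auto
  show "escaping_set lam s \<subseteq> \<psi> ` {0<..}"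
  proof
    fix z assume "z \<in> escaping_set lam s"
    then obtain t where t: "t > 0" "follows t z" using escaping_follows by blast
    then have "z = \<psi> t" using follows_unique follows_\<psi> by blast
    with t show "z \<in> \<psi> ` {0<..}" by auto
  qed
qed

lemma \<psi>_inj: "inj_on \<psi> {0<..}"
  by (rule inj_onI) (metis follows_\<psi> follows_inj greaterThan_iff)

lemma \<psi>_continuous_on: "continuous_on {0<..} \<psi>"
  using continuous_\<psi> by (intro continuous_at_imp_continuous_on) auto

text \<open>The choice operator may return a curve other than \<open>\<psi>\<close>. One over a
  closed ray would lose its endpoint on \<open>{0<..}\<close>;
  \<open>closed_ray_not_open_ray\<close> excludes it, so the chosen curve covers the whole escaping
  set.\<close>

lemma hair_eq_escaping_set: "hair lam s = escaping_set lam s"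
proof -
  define f where "f = (SOME f. hair_parametrization lam s f)"
  have "hair_parametrization lam s \<psi>"
    unfolding hair_parametrization_def using \<psi>_image \<psi>_inj \<psi>_continuous_on \<psi>_at_infinity by blast
  then have f: "hair_parametrization lam s f" unfolding f_def by (rule someI[of "hair_parametrization lam s"])
  then have "f ` {0<..} = escaping_set lam s"
    using closed_ray_not_open_ray[OF \<psi>_continuous_on \<psi>_inj, of f]
    by (auto simp: hair_parametrization_def \<psi>_image)
  then show ?thesis by (simp add: hair_def f_def)
qed

end

section \<open>Limit sets\<close>

lemma limitin_Alexandroff_Some:
  fixes x :: "nat \<Rightarrow> complex"
  shows "limitin (Alexandroff_compactification euclidean) (\<lambda>k. Some (x k)) (Some w) sequentially
    \<longleftrightarrow> x \<longlonglongrightarrow> w" (is "?L \<longleftrightarrow> ?R")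
proof
  assume L: ?L
  show ?R
  proof (rule topological_tendstoI)
    fix V assume "open V" "w \<in> V"
    then have "eventually (\<lambda>k. Some (x k) \<in> Some ` V) sequentially"
      using L unfolding limitin_def by (metis imageI open_openin openin_Alexandroff_compactification_image_Some)
    then show "eventually (\<lambda>k. x k \<in> V) sequentially" by (simp add: inj_image_mem_iff)
  qed
next
  assume R: ?R
  show ?L
    unfolding limitin_def
  proof (intro conjI allI impI)
    fix U assume U: "openin (Alexandroff_compactification euclidean) U \<and> Some w \<in> U"
    then obtain V where V: "open V" "w \<in> V" "Some ` V \<subseteq> U"
      unfolding openin_Alexandroff_compactification
      by (auto simp: open_Compl Compl_eq_Diff_UNIV[symmetric] image_subset_iff)
    from topological_tendstoD[OF R V(1,2)]
    show "eventually (\<lambda>k. Some (x k) \<in> U) sequentially"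
      by eventually_elim (use V in auto)
  qed simp
qed

lemma limitin_Alexandroff_None:
  fixes x :: "nat \<Rightarrow> complex"
  shows "limitin (Alexandroff_compactification euclidean) (\<lambda>k. Some (x k)) None sequentially
    \<longleftrightarrow> filterlim x at_infinity sequentially" (is "?L \<longleftrightarrow> ?R")
proof
  assume L: ?L
  have "eventually (\<lambda>k. r \<le> norm (x k)) sequentially" for r
  proof -
    have "openin (Alexandroff_compactification euclidean) (insert None (Some ` (UNIV - cball 0 r :: complex set)))"
      unfolding openin_Alexandroff_compactification by (intro disjI2 exI[of _ "cball 0 r"]) simp
    then have "eventually (\<lambda>k. Some (x k) \<in> insert None (Some ` (UNIV - cball 0 r))) sequentially"
      using L unfolding limitin_def by blast
    then show ?thesis by eventually_elim auto
  qed
  then show ?R by (simp add: filterlim_at_infinity_conv_norm_at_top filterlim_at_top)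
next
  assume R: ?R
  show ?L
    unfolding limitin_def
  proof (intro conjI allI impI)
    fix U assume U: "openin (Alexandroff_compactification euclidean) U \<and> (None :: complex option) \<in> U"
    then obtain C where C: "compact C" "U = insert None (Some ` (UNIV - C))"
      unfolding openin_Alexandroff_compactification by auto
    from compact_imp_bounded[OF C(1)] obtain r where r: "\<And>z. z \<in> C \<Longrightarrow> norm z \<le> r" 
      unfolding bounded_iff by blast
    have "eventually (\<lambda>k. r + 1 \<le> norm (x k)) sequentially"
      using R by (simp add: filterlim_at_infinity_conv_norm_at_top filterlim_at_top)
    then show "eventually (\<lambda>k. Some (x k) \<in> U) sequentially"
      by eventually_elim (use C r in force)
  qed simp
qed

lemma Some_in_omega_limit:
  "Some w \<in> omega_limit lam z \<longleftrightarrow>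
    (\<exists>m. filterlim m at_top sequentially \<and> (\<lambda>k. (E lam ^^ m k) z) \<longlonglongrightarrow> w)"
  by (simp add: omega_limit_def limitin_Alexandroff_Some)

lemma None_in_omega_limit:
  "None \<in> omega_limit lam z \<longleftrightarrow>
    (\<exists>m. filterlim m at_top sequentially \<and> filterlim (\<lambda>k. (E lam ^^ m k) z) at_infinity sequentially)"
  by (simp add: omega_limit_def limitin_Alexandroff_None)

lemma omega_limit_escaping:
  assumes "filterlim (\<lambda>n. (E lam ^^ n) z) at_infinity sequentially"
  shows "omega_limit lam z = {None}"
proof -
  have "Some w \<notin> omega_limit lam z" for w
  proof
    assume "Some w \<in> omega_limit lam z"
    then obtain m where m: "filterlim m at_top sequentially" "(\<lambda>k. (E lam ^^ m k) z) \<longlonglongrightarrow> w"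
      by (auto simp: Some_in_omega_limit)
    have "filterlim (\<lambda>k. (E lam ^^ m k) z) at_infinity sequentially"
      using filterlim_compose[OF assms m(1)] .
    with m(2) show False using not_tendsto_and_filterlim_at_infinity[of sequentially] by auto
  qed
  moreover have "None \<in> omega_limit lam z"
    using assms filterlim_ident by (auto simp: None_in_omega_limit intro!: exI[of _ "\<lambda>n. n"])
  ultimately show ?thesis by (auto simp: set_eq_iff) (metis option.exhaust)
qed

lemma omega_limit_nonempty:
  assumes "\<not> filterlim (\<lambda>n. (E lam ^^ n) z) at_infinity sequentially"
  shows "\<exists>w. Some w \<in> omega_limit lam z"
proof -
  obtain r where "\<not> eventually (\<lambda>n. r \<le> norm ((E lam ^^ n) z)) sequentially"
    using assms by (auto simp: filterlim_at_infinity_conv_norm_at_top filterlim_at_top)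
  then have "\<exists>\<^sub>\<infinity>n. norm ((E lam ^^ n) z) < r"
    by (simp add: not_eventually cofinite_eq_sequentially not_le)
  then have "infinite {n. norm ((E lam ^^ n) z) < r}" by (simp add: frequently_cofinite)
  then obtain m :: "nat \<Rightarrow> nat" where m: "strict_mono m" "\<And>k. norm ((E lam ^^ m k) z) < r"
    using infinite_enumerate by blast
  have "bounded (range (\<lambda>k. (E lam ^^ m k) z))"
    using m(2) by (intro boundedI[of _ r]) (auto intro: less_imp_le)
  then obtain w l where "strict_mono l" "((\<lambda>k. (E lam ^^ m k) z) \<circ> l) \<longlonglongrightarrow> w"
    using bounded_imp_convergent_subsequence by blast
  then show ?thesis unfolding Some_in_omega_limit
    using filterlim_subseq[OF strict_mono_o[OF m(1) \<open>strict_mono l\<close>]] by (intro exI[of _ w] exI[of _ "m \<circ> l"]) (simp add: o_def)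
qed

lemma omega_limit_frequently:
  assumes "Some w \<in> omega_limit lam z" "e > 0"
  shows "\<exists>m\<ge>N. norm ((E lam ^^ m) z - w) < e"
proof -
  obtain m where m: "filterlim m at_top sequentially" "(\<lambda>k. (E lam ^^ m k) z) \<longlonglongrightarrow> w"
    using assms by (auto simp: Some_in_omega_limit)
  have "eventually (\<lambda>k. dist ((E lam ^^ m k) z) w < e) sequentially" using tendstoD[OF m(2) assms(2)] .
  moreover have "eventually (\<lambda>k. m k \<ge> N) sequentially" using m(1) by (simp add: filterlim_at_top)
  ultimately have "eventually (\<lambda>k. m k \<ge> N \<and> norm ((E lam ^^ m k) z - w) < e) sequentially"
    by eventually_elim (simp add: dist_norm)
  then obtain k where "m k \<ge> N \<and> norm ((E lam ^^ m k) z - w) < e"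
    unfolding eventually_sequentially by blast
  then show ?thesis by blast
qed

lemma omega_limitI:
  assumes "\<And>N. \<exists>m\<ge>N. norm ((E lam ^^ m) z - w) < 1 / (real N + 1)"
  shows "Some w \<in> omega_limit lam z"
proof -
  obtain m where m: "\<And>N. m N \<ge> N" "\<And>N. norm ((E lam ^^ m N) z - w) < 1 / (real N + 1)"
    using assms by metis
  have "filterlim m at_top sequentially"
    using m(1) by (intro filterlim_at_top_mono[OF filterlim_ident]) auto
  moreover have "(\<lambda>N. (E lam ^^ m N) z) \<longlonglongrightarrow> w"
  proof (rule LIM_zero_cancel, rule Lim_null_comparison)
    show "eventually (\<lambda>N. norm ((E lam ^^ m N) z - w) \<le> 1 / (real N + 1)) sequentially"
      by (intro always_eventually allI less_imp_le m(2))
    show "(\<lambda>N. 1 / (real N + 1)) \<longlonglongrightarrow> 0" by real_asymp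
  qed
  ultimately show ?thesis by (auto simp: Some_in_omega_limit)
qed

section \<open>Limit sets contained in the real line and infinity\<close>

context exp_map
begin

lemma omega_limit_forward: "Some w \<in> omega_limit lam z \<Longrightarrow> Some ((E lam ^^ n) w) \<in> omega_limit lam z"
proof -
  assume "Some w \<in> omega_limit lam z"
  then obtain m where m: "filterlim m at_top sequentially" "(\<lambda>k. (E lam ^^ m k) z) \<longlonglongrightarrow> w"
    by (auto simp: Some_in_omega_limit)
  have "(\<lambda>k. (E lam ^^ n) ((E lam ^^ m k) z)) \<longlonglongrightarrow> (E lam ^^ n) w"
    by (rule isCont_tendsto_compose[OF isCont_E_iter m(2)])
  then have "(\<lambda>k. (E lam ^^ (n + m k)) z) \<longlonglongrightarrow> (E lam ^^ n) w" by (simp add: funpow_add)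
  moreover have "filterlim (\<lambda>k. n + m k) at_top sequentially"
    by (rule filterlim_at_top_mono[OF m(1)]) simp
  ultimately show ?thesis unfolding Some_in_omega_limit by blast
qed

text \<open>The tangent bound \<open>lam * exp x \<ge> x + (1 + ln lam)\<close> moves a real point
  to the right by a fixed amount, positive by the hypothesis on \<open>lam\<close>.\<close>

lemma norm_E_iter_0_ge: "real n * (1 + ln lam) \<le> norm ((E lam ^^ n) 0)"
proof -
  define x where "x = (\<lambda>n. ((\<lambda>x. lam * exp x) ^^ n) 0)"
  have "real n * (1 + ln lam) \<le> x n"
  proof (induction n)
    case (Suc n)
    have "1 + ln lam + x n \<le> exp (ln lam + x n)" using exp_ge_add_one_self[of "ln lam + x n"] by (simp only: add.assoc)
    also have "\<dots> = x (Suc n)" using lam_pos by (simp add: x_def exp_add)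
    finally show ?case using Suc by (simp add: algebra_simps)
  qed (simp add: x_def)
  also have "x n \<le> norm (of_real (x n) :: complex)" by simp
  also have "of_real (x n) = (E lam ^^ n) 0" using E_iter_of_real[of n 0] by (simp add: x_def)
  finally show ?thesis .
qed

lemma omega_limit_None_if_Orb0:
  assumes "Some ` Orb0 lam \<subseteq> omega_limit lam z"
  shows "None \<in> omega_limit lam z"
proof -
  have "\<exists>m\<ge>N. real N \<le> norm ((E lam ^^ m) z)" for N
  proof -
    obtain n where n: "real N + 1 < real n * (1 + ln lam)" using reals_Archimedean3[OF ln_lam] by blast
    have "Some ((E lam ^^ n) 0) \<in> omega_limit lam z" using assms by (auto simp: Orb0_def)
    then obtain m where m: "m \<ge> N" "norm ((E lam ^^ m) z - (E lam ^^ n) 0) < 1"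
      using omega_limit_frequently[of _ lam z 1 N] by auto
    have "norm ((E lam ^^ n) 0) \<le> norm ((E lam ^^ m) z) + norm ((E lam ^^ m) z - (E lam ^^ n) 0)"
      using norm_triangle_ineq4[of "(E lam ^^ m) z" "(E lam ^^ m) z - (E lam ^^ n) 0"] by simp
    then show ?thesis using norm_E_iter_0_ge[of n] n m by (intro exI[of _ m]) auto
  qed
  then obtain m where m: "\<And>N. m N \<ge> N" "\<And>N. real N \<le> norm ((E lam ^^ m N) z)" by metis
  have "filterlim m at_top sequentially"
    using m(1) by (intro filterlim_at_top_mono[OF filterlim_ident]) auto
  moreover have "filterlim (\<lambda>N. (E lam ^^ m N) z) at_infinity sequentially"
    unfolding filterlim_at_infinity_conv_norm_at_top
    using m(2) by (intro filterlim_at_top_mono[OF filterlim_real_sequentially]) auto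
  ultimately show ?thesis unfolding None_in_omega_limit by blast
qed

lemma Orb0_Im: "w \<in> Orb0 lam \<Longrightarrow> Im w = 0"
proof -
  assume "w \<in> Orb0 lam"
  then obtain n where "w = (E lam ^^ n) (of_real 0)" by (auto simp: Orb0_def)
  then show "Im w = 0" by (simp only: E_iter_of_real) simp
qed

text \<open>Pulling a limit point back along the real orbit decreases it by at least \<open>1 + ln lam\<close>, so
  the descent can only stop at \<open>0\<close>.\<close>
lemma omega_limit_eq_Orb0:
  assumes ne: "Some w \<in> omega_limit lam z"
    and avoid: "\<And>N. N \<ge> 1 \<Longrightarrow> \<exists>M. \<forall>i\<ge>M. \<bar>Re ((E lam ^^ i) z)\<bar> \<le> real N \<longrightarrow> \<bar>Im ((E lam ^^ i) z)\<bar> < 1 / real N"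
  shows "omega_limit lam z = Some ` Orb0 lam \<union> {None}"
proof -
  have Im0: "(\<lambda>k. Im ((E lam ^^ m k) z)) \<longlonglongrightarrow> 0"
    if m: "filterlim m at_top sequentially" and Re: "(\<lambda>k. Re ((E lam ^^ m k) z)) \<longlonglongrightarrow> x" for m :: "nat \<Rightarrow> nat" and x
  proof (rule tendstoI)
    fix e :: real assume "e > 0"
    obtain N1 :: nat where N1: "\<bar>x\<bar> + 1 \<le> real N1" using real_arch_simple by blast
    obtain N2 :: nat where N2: "1 / e \<le> real N2" using real_arch_simple by blast
    define N where "N = max 1 (max N1 N2)"
    obtain M where M: "\<And>i. i \<ge> M \<Longrightarrow> \<bar>Re ((E lam ^^ i) z)\<bar> \<le> real N \<Longrightarrow> \<bar>Im ((E lam ^^ i) z)\<bar> < 1 / real N"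
      using avoid[of N] by (auto simp: N_def)
    have Ne: "1 / real N \<le> e"
    proof -
      have "1 / e \<le> real N" using N2 by (simp add: N_def)
      then show ?thesis using \<open>e > 0\<close> by (simp add: field_simps N_def)
    qed
    have "eventually (\<lambda>k. dist (Re ((E lam ^^ m k) z)) x < 1) sequentially" using tendstoD[OF Re] by simp
    moreover have "eventually (\<lambda>k. m k \<ge> M) sequentially" using m by (simp add: filterlim_at_top)
    ultimately show "eventually (\<lambda>k. dist (Im ((E lam ^^ m k) z)) 0 < e) sequentially"
    proof eventually_elim
      case (elim k)
      have "\<bar>Re ((E lam ^^ m k) z)\<bar> \<le> real N" using elim(1) N1 by (auto simp: dist_real_def N_def)
      then show ?case using M[OF elim(2)] Ne by (simp add: dist_real_def)
    qed
  qed
  have real: "Im w = 0" if "Some w \<in> omega_limit lam z" for w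
  proof -
    obtain m where m: "filterlim m at_top sequentially" "(\<lambda>k. (E lam ^^ m k) z) \<longlonglongrightarrow> w"
      using \<open>Some w \<in> omega_limit lam z\<close> by (auto simp: Some_in_omega_limit)
    show ?thesis
      using LIMSEQ_unique[OF tendsto_Im[OF m(2)] Im0[OF m(1) tendsto_Re[OF m(2)]]] .
  qed
  \<comment> \<open>Preimages under \<open>E lam\<close> are not unique, so convergence one step
    earlier is not automatic. The modulus fixes the limit of the real parts, and \<open>Im0\<close>
    sends the imaginary parts to \<open>0\<close>.\<close>
  have preimage: "\<exists>\<rho>. Some (of_real \<rho>) \<in> omega_limit lam z \<and> E lam (of_real \<rho>) = w"
    if w: "Some w \<in> omega_limit lam z" "w \<noteq> 0" for w
  proof -
    obtain m where m: "filterlim m at_top sequentially" "(\<lambda>k. (E lam ^^ m k) z) \<longlonglongrightarrow> w"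
      using w by (auto simp: Some_in_omega_limit)
    define l where "l = (\<lambda>k. m k - 1)"
    have l: "filterlim l at_top sequentially"
      unfolding filterlim_at_top
    proof
      fix Z
      have "eventually (\<lambda>k. Z + 1 \<le> m k) sequentially" using m(1) by (simp add: filterlim_at_top)
      then show "eventually (\<lambda>k. Z \<le> l k) sequentially" by eventually_elim (simp add: l_def)
    qed
    have ml: "eventually (\<lambda>k. (E lam ^^ m k) z = E lam ((E lam ^^ l k) z)) sequentially"
    proof -
      have "eventually (\<lambda>k. 1 \<le> m k) sequentially" using m(1) by (simp add: filterlim_at_top)
      then show ?thesis
      proof eventually_elim
        case (elim k)
        then have "m k = Suc (l k)" by (simp add: l_def)
        then show ?case by simp
      qed
    qed
    define \<rho> where "\<rho> = ln (norm w / lam)"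
    have "(\<lambda>k. ln (norm ((E lam ^^ m k) z) / lam)) \<longlonglongrightarrow> \<rho>"
      unfolding \<rho>_def using w(2) lam_pos m(2) by (intro tendsto_intros) auto
    then have Re: "(\<lambda>k. Re ((E lam ^^ l k) z)) \<longlonglongrightarrow> \<rho>"
    proof (rule Lim_transform_eventually)
      show "eventually (\<lambda>k. ln (norm ((E lam ^^ m k) z) / lam) = Re ((E lam ^^ l k) z)) sequentially"
        using ml by eventually_elim (use lam_pos in \<open>simp add: norm_E\<close>)
    qed
    have lim: "(\<lambda>k. (E lam ^^ l k) z) \<longlonglongrightarrow> of_real \<rho>"
      unfolding tendsto_complex_iff using Re Im0[OF l Re] by simp
    have "(\<lambda>k. E lam ((E lam ^^ l k) z)) \<longlonglongrightarrow> E lam (of_real \<rho>)"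
      using isCont_tendsto_compose[OF isCont_E_iter lim, of 1] by simp
    then have "(\<lambda>k. (E lam ^^ m k) z) \<longlonglongrightarrow> E lam (of_real \<rho>)"
      by (rule Lim_transform_eventually) (use ml in \<open>simp add: eq_commute\<close>)
    then have "E lam (of_real \<rho>) = w" using m(2) by (rule LIMSEQ_unique)
    then show ?thesis using l lim unfolding Some_in_omega_limit by blast
  qed
  have descent: "Some 0 \<in> omega_limit lam z \<and> of_real x \<in> Orb0 lam"
    if "Some (of_real x) \<in> omega_limit lam z" "x < real n * (1 + ln lam)" for n x
    using that
  proof (induction n arbitrary: x)
    case 0
    then have "(of_real x :: complex) \<noteq> 0" by auto
    from preimage[OF 0(1) this] obtain \<rho> where "E lam (of_real \<rho>) = of_real x" by blast
    then have "of_real (lam * exp \<rho>) = (of_real x :: complex)" by (simp add: E_def exp_of_real)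
    then have "lam * exp \<rho> = x" by (simp only: of_real_eq_iff)
    then have "x > 0" using lam_pos by auto
    with 0 show ?case by simp
  next
    case (Suc n)
    show ?case
    proof (cases "x = 0")
      case True
      then show ?thesis using Suc.prems by (auto simp: Orb0_def intro!: image_eqI[of _ _ 0])
    next
      case False
      then have "(of_real x :: complex) \<noteq> 0" by auto
      from preimage[OF Suc.prems(1) this] obtain \<rho> where \<rho>: "Some (of_real \<rho>) \<in> omega_limit lam z"
        "E lam (of_real \<rho>) = of_real x" by blast
      from \<rho>(2) have "of_real (lam * exp \<rho>) = (of_real x :: complex)" by (simp add: E_def exp_of_real)
      then have "lam * exp \<rho> = x" by (simp only: of_real_eq_iff)
      moreover have "1 + (ln lam + \<rho>) \<le> exp (ln lam + \<rho>)" by (rule exp_ge_add_one_self)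
      moreover have "exp (ln lam + \<rho>) = lam * exp \<rho>" using lam_pos by (simp add: exp_add)
      ultimately have "1 + (ln lam + \<rho>) \<le> x" by linarith
      then have "\<rho> < real n * (1 + ln lam)" using Suc.prems(2) by (simp add: algebra_simps)
      from Suc.IH[OF \<rho>(1) this] obtain j where "Some 0 \<in> omega_limit lam z" "of_real \<rho> = (E lam ^^ j) 0"
        by (auto simp: Orb0_def)
      moreover from this \<rho>(2) have "of_real x = (E lam ^^ Suc j) 0" by simp
      ultimately show ?thesis unfolding Orb0_def by blast
    qed
  qed
  have fin: "Some 0 \<in> omega_limit lam z \<and> w \<in> Orb0 lam" if w: "Some w \<in> omega_limit lam z" for w
  proof -
    have e: "w = of_real (Re w)" using real[OF w] by (simp add: complex_eq_iff)
    obtain n where "Re w < real n * (1 + ln lam)" using reals_Archimedean3[OF ln_lam] by blast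
    then show ?thesis using descent[of "Re w" n] w e by simp
  qed
  have "Some ` Orb0 lam \<subseteq> omega_limit lam z"
    using omega_limit_forward[of 0 z] fin[OF ne] by (auto simp: Orb0_def)
  moreover from this have "None \<in> omega_limit lam z" by (rule omega_limit_None_if_Orb0)
  moreover have "omega_limit lam z \<subseteq> Some ` Orb0 lam \<union> {None}"
  proof
    fix w assume "w \<in> omega_limit lam z"
    then show "w \<in> Some ` Orb0 lam \<union> {None}" using fin by (cases w) auto
  qed
  ultimately show ?thesis by auto
qed

end

section \<open>The central point and the dichotomy for all other points\<close>

lemma sgn_Im_strip: "z \<in> strip j \<Longrightarrow> j \<noteq> 0 \<Longrightarrow> sgn (Im z) = of_int (sgn j)"
  using sgn_of_strip_pos[of z j] sgn_of_strip_neg[of z j] by (cases "j > 0") auto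

text \<open>The interface between the dynamics and the choice of the zero blocks. A zero run
  occupies the times from \<open>a p\<close> to just before \<open>b p\<close>.
  \<open>offaxis (d p)\<close> is where an orbit may be caught between \<open>b p\<close> and
  \<open>b (Suc p)\<close>, and \<open>offaxis (c p)\<close> is where this places it at time
  \<open>b p\<close>. \<open>near\<close> and \<open>close\<close> are what the length of the run
  must achieve.\<close>

locale block_itinerary = slow_itinerary lam s + exp_map_fixed lam q
  for lam :: real and s :: "nat \<Rightarrow> int" and q :: complex +
  fixes a b :: "nat \<Rightarrow> nat" and c d :: "nat \<Rightarrow> real"
  assumes ab: "a p \<le> b p" and ba: "b p < a (Suc p)"
    and zero_run: "\<lbrakk>a p \<le> i; i < b p\<rbrakk> \<Longrightarrow> s i = 0" and s_b: "s (b p) \<noteq> 0"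
    and d_ge: "\<lbrakk>b p \<le> i; i < b (Suc p)\<rbrakk> \<Longrightarrow> real p + (2 * \<bar>real_of_int (s i)\<bar> + 1) * pi \<le> d p"
    and c_q_le: "c_q \<le> d p"
    and offaxis_seg: "\<lbrakk>b p \<le> m; m \<le> b (Suc p); z \<in> offaxis (d p)\<rbrakk> \<Longrightarrow> pull lam (map s [b p..<m]) z \<in> offaxis (c p)"
    and near: "z \<in> offaxis (c p) \<Longrightarrow>
      norm (fold_upper ((branch lam 0 ^^ (b p - a p)) z) - q) < min (Im q / 2) (1 / (real p + 1))"
    and close: "\<lbrakk>z \<in> offaxis (c p); z' \<in> offaxis (c p); sgn (Im z) = sgn (Im z')\<rbrakk> \<Longrightarrow>
      norm (pull lam (map s [0..<a p]) ((branch lam 0 ^^ (b p - a p)) z) -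
        pull lam (map s [0..<a p]) ((branch lam 0 ^^ (b p - a p)) z')) < 1 / (real p + 1)"
begin

lemma b_strict_mono: "strict_mono b"
  using ab ba by (intro strict_monoI_Suc) (meson less_le_trans)

lemma a_strict_mono: "strict_mono a"
  using ab ba by (intro strict_monoI_Suc) (meson le_less_trans)

lemma b_ge: "p \<le> b p" and a_ge: "p \<le> a p"
  using b_strict_mono a_strict_mono by (auto intro: strict_mono_imp_increasing)

lemma pull_split: "i \<le> j \<Longrightarrow> j \<le> k \<Longrightarrow> pull lam (map s [i..<k]) w = pull lam (map s [i..<j]) (pull lam (map s [j..<k]) w)"
  by (metis le_add_diff_inverse map_append pull_simps(3) upt_add_eq_append)

lemma pull_zero_run: "pull lam (map s [a p..<b p]) w = (branch lam 0 ^^ (b p - a p)) w"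
proof -
  have "map s [a p..<b p] = replicate (b p - a p) 0"
    using zero_run by (intro replicate_eqI) auto
  then show ?thesis by (simp add: pull_replicate)
qed

text \<open>Going backwards, the zero run forgets the radius \<open>c (Suc p)\<close>: at its
  beginning the point is in \<open>offaxis c_q\<close>, which is contained in every
  \<open>offaxis (d p)\<close>.\<close>

lemma offaxis_down: "w \<in> offaxis (c (Suc p)) \<Longrightarrow> pull lam (map s [b p..<b (Suc p)]) w \<in> offaxis (c p)"
proof -
  assume w: "w \<in> offaxis (c (Suc p))"
  let ?v = "(branch lam 0 ^^ (b (Suc p) - a (Suc p))) w"
  have "?v \<in> offaxis c_q" using near[OF w] by (intro near_q_offaxis) auto
  then have v: "?v \<in> offaxis (d p)" using offaxis_mono[OF c_q_le] by blast
  have "pull lam (map s [b p..<b (Suc p)]) w = pull lam (map s [b p..<a (Suc p)]) ?v"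
    using ab[of "Suc p"] ba[of p] by (subst pull_split[of _ "a (Suc p)"]) (auto simp: pull_zero_run)
  also have "\<dots> \<in> offaxis (c p)" using offaxis_seg[OF _ _ v, of "a (Suc p)"] ab[of "Suc p"] ba[of p] by auto
  finally show ?thesis .
qed

lemma offaxis_down_many: "p \<le> p' \<Longrightarrow> w \<in> offaxis (c p') \<Longrightarrow> pull lam (map s [b p..<b p']) w \<in> offaxis (c p)"
proof (induction rule: inc_induct)
  case base
  then show ?case by simp
next
  case (step n)
  have "b n \<le> b (Suc n)" "b (Suc n) \<le> b p'" 
    using strict_mono_less_eq[OF b_strict_mono] step by auto
  then show ?case using offaxis_down[OF step.IH[OF step.prems]]
    by (subst pull_split[of "b n" "b (Suc n)" "b p'"]) auto
qed

lemma orbit_offaxis_down: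
  assumes "z \<in> itinerary_set lam s" "p \<le> p'" "(E lam ^^ b p') z \<in> offaxis (c p')"
  shows "(E lam ^^ b p) z \<in> offaxis (c p)"
  using offaxis_down_many[OF assms(2,3)] orbit_pull[OF assms(1), of "b p" "b p'"]
    strict_mono_less_eq[OF b_strict_mono] assms(2) by simp

text \<open>The non-zero entry at \<open>b p\<close> determines the sign of the imaginary part of
  both points, so the zero run draws both to the same fixed point; this is the sign condition in
  \<open>close\<close>.\<close>

lemma pull_close:
  assumes "w \<in> offaxis (c p)" "w' \<in> offaxis (c p)" "w \<in> strip (s (b p))" "w' \<in> strip (s (b p))"
  shows "norm (pull lam (map s [0..<b p]) w - pull lam (map s [0..<b p]) w') < 1 / (real p + 1)"
  using close[OF assms(1,2)] sgn_Im_strip[OF assms(3) s_b] sgn_Im_strip[OF assms(4) s_b] ab[of p]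
  by (simp add: pull_split[of 0 "a p" "b p"] pull_zero_run)

lemma central_point_unique:
  assumes z: "z \<in> itinerary_set lam s" "\<And>p. (E lam ^^ b p) z \<in> offaxis (c p)"
    and z': "z' \<in> itinerary_set lam s" "\<And>p. (E lam ^^ b p) z' \<in> offaxis (c p)"
  shows "z = z'"
proof -
  have "norm (z - z') < 1 / (real p + 1)" for p
    using pull_close[OF z(2) z'(2), of p] orbit_pull_0[OF z(1)] orbit_pull_0[OF z'(1)] z(1) z'(1)
    by (simp add: itinerary_set_def)
  moreover have "(\<lambda>p. 1 / (real p + 1)) \<longlonglongrightarrow> 0" by real_asymp
  ultimately have "norm (z - z') \<le> 0" by (intro LIMSEQ_le_const) (auto intro: less_imp_le)
  then show ?thesis by simp
qed

text \<open>A point of the required strip is placed at time \<open>b p\<close> and pulled back to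
  time \<open>0\<close>. All later approximants also pass through \<open>offaxis (c p)\<close> at
  time \<open>b p\<close>, so \<open>pull_close\<close> makes them Cauchy.\<close>

lemma central_point_exists:
  "\<exists>z\<in>itinerary_set lam s. \<forall>p. (E lam ^^ b p) z \<in> offaxis (c p)"
proof -
  define v where "v = (\<lambda>p. Complex 0 (2 * pi * of_int (s (b p))))"
  have v_strip: "v p \<in> strip (s (b p))" for p using pi_gt_zero by (simp add: v_def strip_def algebra_simps)
  have v_offaxis: "v p \<in> offaxis (c p)" for p
  proof -
    have "b p < b (Suc p)" using b_strict_mono by (simp add: strict_mono_Suc_iff)
    then have d: "(2 * \<bar>real_of_int (s (b p))\<bar> + 1) * pi \<le> d p" using d_ge[of p "b p"] by simp
    have s1: "1 \<le> \<bar>real_of_int (s (b p))\<bar>" using s_b[of p] by linarith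
    have "norm (v p) = 2 * pi * \<bar>real_of_int (s (b p))\<bar>" by (simp add: v_def cmod_def abs_mult)
    also have "\<dots> \<le> (2 * \<bar>real_of_int (s (b p))\<bar> + 1) * pi" using pi_gt_zero by (simp add: algebra_simps)
    also have "\<dots> \<le> d p" by (rule d)
    finally have n: "norm (v p) \<le> d p" .
    have "1 * 1 \<le> 2 * pi * \<bar>real_of_int (s (b p))\<bar>" using s1 pi_ge_two by (intro mult_mono) auto
    then have i: "1 \<le> \<bar>Im (v p)\<bar>" by (simp add: v_def abs_mult)
    have "1 \<le> d p" using n i abs_Im_le_cmod[of "v p"] by linarith
    then have "v p \<in> offaxis (d p)" using n i by (intro in_offaxisI[where e = 1]) auto
    \<comment> \<open>The pullback over the empty word shows that \<open>offaxis (d p)\<close> is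
      contained in \<open>offaxis (c p)\<close>.\<close>
    from offaxis_seg[OF _ _ this, of "b p"] \<open>b p < b (Suc p)\<close> show ?thesis by simp
  qed
  have v_nr: "Im (v p) \<noteq> 0" for p by (rule offaxis_Im_nonzero[OF v_offaxis])
  define y where "y = (\<lambda>p. pull lam (map s [0..<b p]) (v p))"
  have b_mono: "b p \<le> b p'" if "p \<le> p'" for p p' using strict_mono_less_eq[OF b_strict_mono] that by simp
  have Ey: "(E lam ^^ i) (y p) = pull lam (map s [i..<b p]) (v p)" if "i \<le> b p" for i p
    using E_iter_pull[OF v_nr, of i "map s [0..<b p]"] that by (simp add: y_def drop_map)
  have Ey_strip: "(E lam ^^ i) (y p) \<in> strip (s i)" if "i \<le> b p" for i p
  proof (cases "i < b p")
    case True
    then show ?thesis using pull_in_strip[OF v_nr, of i "map s [0..<b p]"] by (simp add: y_def)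
  next
    case False
    then show ?thesis using that Ey[of "b p" p] v_strip by simp
  qed
  have Ey_offaxis: "(E lam ^^ b p) (y p') \<in> offaxis (c p)" if "p \<le> p'" for p p'
    using offaxis_down_many[OF that v_offaxis] Ey[OF b_mono[OF that]] by simp
  have y_pull: "y p' = pull lam (map s [0..<b p]) ((E lam ^^ b p) (y p'))" if "p \<le> p'" for p p'
    unfolding Ey[OF b_mono[OF that]] using b_mono[OF that] by (simp add: y_def pull_split[of 0 "b p" "b p'"])
  have y_close: "norm (y p - y p') < 1 / (real p + 1)" if "p \<le> p'" for p p'
    using pull_close[OF Ey_offaxis[OF order_refl] Ey_offaxis[OF that] Ey_strip[OF order_refl] Ey_strip[OF b_mono[OF that]]]
      y_pull[OF that] y_pull[OF order_refl] by simp
  have "Cauchy y"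
  proof (rule CauchyI')
    fix e :: real assume "e > 0"
    have "(\<lambda>p. 1 / (real p + 1)) \<longlonglongrightarrow> 0" by real_asymp
    then have "eventually (\<lambda>p. 1 / (real p + 1) < e) sequentially" using order_tendstoD(2) \<open>e > 0\<close> by blast
    then obtain M where M: "\<And>p. p \<ge> M \<Longrightarrow> 1 / (real p + 1) < e" by (auto simp: eventually_sequentially)
    show "\<exists>M. \<forall>m\<ge>M. \<forall>n>m. dist (y m) (y n) < e"
    proof (intro exI[of _ M] allI impI)
      fix m n assume "M \<le> m" "m < n"
      then show "dist (y m) (y n) < e" using y_close[of m n] M[of m] by (simp add: dist_norm)
    qed
  qed
  then obtain z where z: "y \<longlonglongrightarrow> z" using Cauchy_convergent convergent_def by blast
  have Ez: "(\<lambda>p'. (E lam ^^ i) (y p')) \<longlonglongrightarrow> (E lam ^^ i) z" for i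
    by (rule isCont_tendsto_compose[OF isCont_E_iter z])
  have z_offaxis: "(E lam ^^ b p) z \<in> offaxis (c p)" for p
  proof (rule Lim_in_closed_set[OF compact_imp_closed[OF compact_offaxis] _ _ Ez])
    show "eventually (\<lambda>p'. (E lam ^^ b p) (y p') \<in> offaxis (c p)) sequentially"
      using Ey_offaxis unfolding eventually_sequentially by blast
  qed simp
  \<comment> \<open>As strips are not closed, the itinerary of the limit is obtained from its
    representation as a pullback; the compact sets keep the starting points off the cuts of the
    branches.\<close>
  have z_pull: "z = pull lam (map s [0..<b p]) ((E lam ^^ b p) z)" for p
  proof (rule LIMSEQ_unique[OF z])
    have "(\<lambda>p'. pull lam (map s [0..<b p]) ((E lam ^^ b p) (y p')))
        \<longlonglongrightarrow> pull lam (map s [0..<b p]) ((E lam ^^ b p) z)"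
      by (rule isCont_tendsto_compose[OF isCont_pull[OF offaxis_Im_nonzero[OF z_offaxis]] Ez])
    then show "y \<longlonglongrightarrow> pull lam (map s [0..<b p]) ((E lam ^^ b p) z)"
    proof (rule Lim_transform_eventually)
      show "eventually (\<lambda>p'. pull lam (map s [0..<b p]) ((E lam ^^ b p) (y p')) = y p') sequentially"
        unfolding eventually_sequentially using y_pull by (intro exI[of _ p]) (metis)
    qed
  qed
  have "(E lam ^^ j) z \<in> strip (s j)" for j
  proof -
    have j: "j < b (Suc j)" using b_ge[of "Suc j"] by simp
    then have "(E lam ^^ j) (pull lam (map s [0..<b (Suc j)]) ((E lam ^^ b (Suc j)) z)) \<in> strip (map s [0..<b (Suc j)] ! j)"
      by (intro pull_in_strip offaxis_Im_nonzero[OF z_offaxis]) auto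
    then show ?thesis using j by (simp flip: z_pull)
  qed
  then show ?thesis using z_offaxis by (auto simp: itinerary_set_def)
qed

text \<open>At the beginning \<open>a p\<close> of each zero run the orbit is within
  \<open>1 / (p + 1)\<close> of \<open>q\<close> or of \<open>cnj q\<close>, and one of the two
  alternatives occurs for infinitely many \<open>p\<close>.\<close>

lemma central_point_omega:
  assumes "z \<in> itinerary_set lam s" "\<And>p. (E lam ^^ b p) z \<in> offaxis (c p)"
  shows "Some q \<in> omega_limit lam z \<or> Some (cnj q) \<in> omega_limit lam z"
proof -
  have n: "norm (fold_upper ((E lam ^^ a p) z) - q) < 1 / (real p + 1)" for p
    using near[OF assms(2), of p] orbit_pull[OF assms(1) ab, of p] by (simp add: pull_zero_run)
  have le: "1 / (real p + 1) \<le> 1 / (real N + 1)" if "N \<le> p" for N p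
    using that by (intro divide_left_mono) auto
  show ?thesis
  proof (cases "\<forall>N. \<exists>p\<ge>N. Im ((E lam ^^ a p) z) \<ge> 0")
    case True
    have "Some q \<in> omega_limit lam z"
    proof (rule omega_limitI)
      fix N
      obtain p where p: "p \<ge> N" "Im ((E lam ^^ a p) z) \<ge> 0" using True by blast
      then have "norm ((E lam ^^ a p) z - q) < 1 / (real N + 1)"
        using n[of p] le[of N p] by (simp add: fold_upper_cases)
      then show "\<exists>m\<ge>N. norm ((E lam ^^ m) z - q) < 1 / (real N + 1)"
        using a_ge[of p] p by (intro exI[of _ "a p"]) auto
    qed
    then show ?thesis ..
  next
    case False
    then obtain N0 where N0: "\<And>p. p \<ge> N0 \<Longrightarrow> Im ((E lam ^^ a p) z) < 0"
      unfolding not_all not_ex not_le de_Morgan_conj by (meson leD)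
    have "Some (cnj q) \<in> omega_limit lam z"
    proof (rule omega_limitI)
      fix N
      define p where "p = max N N0"
      have "norm (cnj ((E lam ^^ a p) z) - q) < 1 / (real N + 1)"
        using n[of p] le[of N p] N0[of p] by (simp add: fold_upper_cases p_def)
      moreover have "norm (cnj ((E lam ^^ a p) z) - q) = norm ((E lam ^^ a p) z - cnj q)"
        using complex_mod_cnj[of "(E lam ^^ a p) z - cnj q"] by (simp only: complex_cnj_diff complex_cnj_cnj)
      ultimately have "norm ((E lam ^^ a p) z - cnj q) < 1 / (real N + 1)" by simp
      then show "\<exists>m\<ge>N. norm ((E lam ^^ m) z - cnj q) < 1 / (real N + 1)"
        using a_ge[of p] by (intro exI[of _ "a p"]) (auto simp: p_def)
    qed
    then show ?thesis ..
  qed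
qed

text \<open>A late visit to \<open>offaxis (d p)\<close> would put the orbit into
  \<open>offaxis (c p)\<close> at time \<open>b p\<close> and, by descent, into
  \<open>offaxis (c p0)\<close> at time \<open>b p0\<close>. As \<open>d p\<close> is at least
  \<open>p\<close> plus the height of the strip visited, this rules out every bounded region off the
  axis.\<close>

lemma noncentral_avoids:
  assumes z: "z \<in> itinerary_set lam s" and p0: "(E lam ^^ b p0) z \<notin> offaxis (c p0)" and N: "N \<ge> 1"
  shows "\<exists>M. \<forall>i\<ge>M. \<bar>Re ((E lam ^^ i) z)\<bar> \<le> real N \<longrightarrow> \<bar>Im ((E lam ^^ i) z)\<bar> < 1 / real N"
proof (intro exI[of _ "b (max p0 N)"] allI impI, rule ccontr)
  fix i assume i: "b (max p0 N) \<le> i" and Re: "\<bar>Re ((E lam ^^ i) z)\<bar> \<le> real N"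
    and Im: "\<not> \<bar>Im ((E lam ^^ i) z)\<bar> < 1 / real N"
  define p where "p = (GREATEST p. b p \<le> i)"
  have bd: "p \<le> i" if "b p \<le> i" for p using b_ge[of p] that by simp
  have p: "b p \<le> i" "max p0 N \<le> p" unfolding p_def
    using GreatestI_nat[where P = "\<lambda>p. b p \<le> i", OF i bd] Greatest_le_nat[where P = "\<lambda>p. b p \<le> i", OF i bd] by auto
  have i_less: "i < b (Suc p)"
  proof (rule ccontr)
    assume "\<not> i < b (Suc p)"
    then have "Suc p \<le> p" unfolding p_def using Greatest_le_nat[where P = "\<lambda>p. b p \<le> i", OF _ bd, of "Suc p"] 
      by (simp add: p_def)
    then show False by simp
  qed
  note d = d_ge[OF p(1) i_less]
  have Im_le: "\<bar>Im ((E lam ^^ i) z)\<bar> \<le> (2 * \<bar>real_of_int (s i)\<bar> + 1) * pi"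
    using z unfolding itinerary_set_def by (intro abs_Im_strip) blast
  then have n: "norm ((E lam ^^ i) z) \<le> d p"
    using cmod_le[of "(E lam ^^ i) z"] Im_le Re d p(2) by linarith
  have "0 \<le> (2 * \<bar>real_of_int (s i)\<bar> + 1) * pi" by simp
  then have "real N \<le> d p" using d p(2) by linarith
  then have "1 \<le> d p * (1 / real N)" using N by (simp add: field_simps)
  then have "(E lam ^^ i) z \<in> offaxis (d p)" using n Im by (intro in_offaxisI[where e = "1 / real N"]) auto
  then have bp: "(E lam ^^ b p) z \<in> offaxis (c p)"
    using offaxis_seg[OF p(1) _, of "(E lam ^^ i) z"] i_less orbit_pull[OF z p(1)] by simp
  then show False using orbit_offaxis_down[OF z _ bp] p(2) p0 by auto
qed

lemma noncentral_omega:
  assumes "z \<in> itinerary_set lam s" "z \<notin> escaping_set lam s" "(E lam ^^ b p0) z \<notin> offaxis (c p0)"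
  shows "omega_limit lam z = Some ` Orb0 lam \<union> {None}"
proof -
  obtain w where "Some w \<in> omega_limit lam z"
    using omega_limit_nonempty[of lam z] assms by (auto simp: escaping_set_def)
  then show ?thesis by (rule omega_limit_eq_Orb0) (rule noncentral_avoids[OF assms(1,3)])
qed

lemma central_and_noncentral_points:
  "\<exists>zs\<in>itinerary_set lam s. (Some (q_plus lam) \<in> omega_limit lam zs \<or> Some (q_minus lam) \<in> omega_limit lam zs) \<and>
    (\<forall>z\<in>itinerary_set lam s - (hair lam s \<union> {zs}). omega_limit lam z = Some ` Orb0 lam \<union> {None})"
proof -
  obtain zs where zs: "zs \<in> itinerary_set lam s" "\<And>p. (E lam ^^ b p) zs \<in> offaxis (c p)"
    using central_point_exists by blast
  show ?thesis
  proof (intro bexI[OF _ zs(1)] conjI ballI)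
    show "Some (q_plus lam) \<in> omega_limit lam zs \<or> Some (q_minus lam) \<in> omega_limit lam zs"
      using central_point_omega[OF zs] by (simp add: q_plus_eq q_minus_eq)
    fix z assume z: "z \<in> itinerary_set lam s - (hair lam s \<union> {zs})"
    then have "\<not> (\<forall>p. (E lam ^^ b p) z \<in> offaxis (c p))" using central_point_unique[OF zs, of z] by blast
    then show "omega_limit lam z = Some ` Orb0 lam \<union> {None}"
      using noncentral_omega z by (auto simp: hair_eq_escaping_set)
  qed
qed

end

section \<open>The choice of the zero blocks\<close>

lemma block_sequence_prefix:
  assumes "\<And>p. t p \<noteq> []" "pre 0 = []" "\<And>p. pre (Suc p) = pre p @ replicate (n p) 0 @ t p"
    and "i < length (pre p)"
  shows "block_sequence n t i = pre p ! i"
proof -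
  define f where "f = (\<lambda>q. replicate (n q) 0 @ t q)"
  have "flat (smap f nats) = pre p @- flat (smap f (fromN p))"
  proof (induction p)
    case (Suc p)
    have "smap f (fromN p) = f p ## smap f (fromN (Suc p))" by (subst siterate.code) simp
    moreover have "f p \<noteq> []" using assms(1) by (simp add: f_def)
    ultimately have "flat (smap f (fromN p)) = f p @- flat (smap f (fromN (Suc p)))" by simp
    then show ?case using Suc assms(3) by (simp add: f_def)
  qed (simp add: assms)
  then show ?thesis using assms(4) by (simp add: block_sequence_def f_def)
qed

lemma (in exp_map) branch_0_iter_Im_neg: "Im z < 0 \<Longrightarrow> Im ((branch lam 0 ^^ n) z) < 0"
  by (induction n) (auto simp: Im_branch_0_neg)

context exp_map_fixed
begin

text \<open>The sign tells which fixed point attracts, and \<open>pull lam xs\<close> is continuous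
  at both. Since \<open>xs\<close> is fixed before \<open>N\<close>, continuity replaces any
  estimate along \<open>xs\<close>.\<close>

lemma pull_branch_0_iter_close:
  assumes "e > 0"
  shows "\<exists>N. \<forall>n\<ge>N. \<forall>z\<in>offaxis c. \<forall>z'\<in>offaxis c. sgn (Im z) = sgn (Im z') \<longrightarrow>
    norm (pull lam xs ((branch lam 0 ^^ n) z) - pull lam xs ((branch lam 0 ^^ n) z')) < e"
proof -
  have "isCont (pull lam xs) q" "isCont (pull lam xs) (cnj q)" using Im_q by (auto intro!: isCont_pull)
  then obtain \<delta>1 \<delta>2 where \<delta>: "\<delta>1 > 0" "\<And>w. norm (w - q) < \<delta>1 \<Longrightarrow> norm (pull lam xs w - pull lam xs q) < e / 2"
    "\<delta>2 > 0" "\<And>w. norm (w - cnj q) < \<delta>2 \<Longrightarrow> norm (pull lam xs w - pull lam xs (cnj q)) < e / 2"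
    unfolding continuous_at_eps_delta dist_norm using assms by (metis half_gt_zero)
  obtain N where N: "\<And>n z. n \<ge> N \<Longrightarrow> z \<in> offaxis c \<Longrightarrow> norm (fold_upper ((branch lam 0 ^^ n) z) - q) < min \<delta>1 \<delta>2"
    using branch_0_iter_tendsto[of "min \<delta>1 \<delta>2" c] \<delta>(1,3) by (metis min_less_iff_conj)
  have near: "norm (pull lam xs ((branch lam 0 ^^ n) z) - pull lam xs (if Im z > 0 then q else cnj q)) < e / 2"
    if n: "n \<ge> N" and z: "z \<in> offaxis c" for n z
  proof (cases "Im z > 0")
    case True
    then show ?thesis using N[OF n z] branch_0_iter_Im_pos[OF True, of n] \<delta>(2)[of "(branch lam 0 ^^ n) z"]
      by (simp add: fold_upper_cases)
  next
    case False
    have nz: "Im z \<noteq> 0" using offaxis_Im_nonzero[OF z] .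
    have "Im ((branch lam 0 ^^ n) z) < 0" using False nz by (intro branch_0_iter_Im_neg) simp
    then have "fold_upper ((branch lam 0 ^^ n) z) = cnj ((branch lam 0 ^^ n) z)" by (simp add: fold_upper_cases)
    then have "norm (cnj ((branch lam 0 ^^ n) z - cnj q)) < \<delta>2" using N[OF n z] by simp
    then show ?thesis using False \<delta>(4) by (simp only: complex_mod_cnj if_False)
  qed
  show ?thesis
  proof (intro exI[of _ N] allI impI ballI)
    fix n z z' assume n: "N \<le> n" and z: "z \<in> offaxis c" "z' \<in> offaxis c" and sgn: "sgn (Im z) = sgn (Im z')"
    have "Im z > 0 \<longleftrightarrow> Im z' > 0" using sgn by (metis sgn_greater)
    then obtain p where "norm (pull lam xs ((branch lam 0 ^^ n) z) - p) < e / 2"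
        "norm (pull lam xs ((branch lam 0 ^^ n) z') - p) < e / 2"
      using near[OF n z(1)] near[OF n z(2)] by (cases "Im z > 0") auto
    then show "norm (pull lam xs ((branch lam 0 ^^ n) z) - pull lam xs ((branch lam 0 ^^ n) z')) < e"
      using norm_triangle_ineq4[of "pull lam xs ((branch lam 0 ^^ n) z) - p" "pull lam xs ((branch lam 0 ^^ n) z') - p"]
      by simp
  qed
qed

lemma c_q_nonneg: "0 \<le> c_q"
  using Im_q norm_ge_zero[of q] unfolding c_q_def by (intro add_nonneg_nonneg) auto

lemma exists_block_itinerary:
  fixes t :: "nat \<Rightarrow> int list"
  assumes t: "\<And>m. \<exists>x\<in>set (t m). x \<noteq> 0"
  shows "\<exists>n a b c d. block_itinerary lam (block_sequence n t) q a b c d"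
proof -
  define J where "J = (\<lambda>p. Max (abs ` set (t p)))"
  have J: "\<bar>x\<bar> \<le> J p" if "x \<in> set (t p)" for x p using that by (auto simp: J_def)
  have J0: "0 \<le> J p" for p using t[of p] J[of _ p] by (meson abs_ge_zero order_trans)
  \<comment> \<open>\<open>c_q\<close> admits the arrival near a fixed point, \<open>real p\<close>
    makes the sets exhaust the complement of the real axis, and the last term covers the imaginary
    parts in strips of index at most \<open>J p\<close>.\<close>
  define d where "d = (\<lambda>p. c_q + real p + (2 * real_of_int (J p) + 1) * pi)"
  have "\<exists>c. \<forall>xs n. \<forall>z\<in>offaxis (d p). length xs \<le> length (t p) \<and> (\<forall>x\<in>set xs. \<bar>x\<bar> \<le> J p) \<longrightarrow> 
     pull lam (xs @ replicate n 0) z \<in> offaxis c" for p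
    using pull_zeros_offaxis[of "d p" "length (t p)" "J p"] by blast
  then obtain c where c: "\<And>p xs n z. z \<in> offaxis (d p) \<Longrightarrow> length xs \<le> length (t p) \<Longrightarrow>
      (\<forall>x\<in>set xs. \<bar>x\<bar> \<le> J p) \<Longrightarrow> pull lam (xs @ replicate n 0) z \<in> offaxis (c p)"
    by metis
  \<comment> \<open>\<open>good p xs n\<close> says that a run of \<open>n\<close> zeros after the
    word \<open>xs\<close> serves block \<open>p\<close>. It will be required for all large
    \<open>n\<close>, since leading zeros of \<open>t p\<close> prolong the run.\<close>
  define good where "good = (\<lambda>p xs n.
    (\<forall>z\<in>offaxis (c p). norm (fold_upper ((branch lam 0 ^^ n) z) - q) < min (Im q / 2) (1 / (real p + 1))) \<and>
    (\<forall>z\<in>offaxis (c p). \<forall>z'\<in>offaxis (c p). sgn (Im z) = sgn (Im z') \<longrightarrow>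
      norm (pull lam xs ((branch lam 0 ^^ n) z) - pull lam xs ((branch lam 0 ^^ n) z')) < 1 / (real p + 1)))"
  have "\<exists>N. (\<forall>n\<ge>N. good p xs n) \<and> length xs \<le> N \<and> J p \<le> int N \<and> 1 \<le> N" for p xs
  proof -
    obtain N1 where N1: "\<And>n z. n \<ge> N1 \<Longrightarrow> z \<in> offaxis (c p) \<Longrightarrow>
        norm (fold_upper ((branch lam 0 ^^ n) z) - q) < min (Im q / 2) (1 / (real p + 1))"
      using branch_0_iter_tendsto[of "min (Im q / 2) (1 / (real p + 1))" "c p"] Im_q by auto
    obtain N2 where N2: "\<And>n z z'. n \<ge> N2 \<Longrightarrow> z \<in> offaxis (c p) \<Longrightarrow> z' \<in> offaxis (c p) \<Longrightarrow> sgn (Im z) = sgn (Im z') \<Longrightarrow>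
        norm (pull lam xs ((branch lam 0 ^^ n) z) - pull lam xs ((branch lam 0 ^^ n) z')) < 1 / (real p + 1)"
      using pull_branch_0_iter_close[of "1 / (real p + 1)" "c p" xs] by auto
    \<comment> \<open>Besides the conditions of \<open>good\<close>, the summand
      \<open>length xs\<close> makes the run at least as long as its starting time,
      \<open>nat (J p)\<close> puts the entries of \<open>t p\<close> at positions no smaller than
      their size, and \<open>1\<close> keeps the run non-empty.\<close>
    show ?thesis
      by (intro exI[of _ "N1 + N2 + length xs + nat (J p) + 1"]) (use N1 N2 in \<open>auto simp: good_def\<close>)
  qed
  then obtain N where N: "\<And>p xs n. n \<ge> N p xs \<Longrightarrow> good p xs n" "\<And>p xs. length xs \<le> N p xs"
     "\<And>p xs. J p \<le> int (N p xs)" "\<And>p xs. 1 \<le> N p xs"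
    by metis
  \<comment> \<open>The length of a zero block depends on the word before it, so the words are built
    by recursion and \<open>n\<close> is read off from them.\<close>
  define pre where "pre = rec_nat [] (\<lambda>p xs. xs @ replicate (N p xs) 0 @ t p)"
  define n where "n = (\<lambda>p. N p (pre p))"
  define s where "s = block_sequence n t"
  define a where "a = (\<lambda>p. length (pre p))"
  define b where "b = (\<lambda>p. a p + n p + length (takeWhile (\<lambda>x. x = 0) (t p)))"
  have pre: "pre 0 = []" "\<And>p. pre (Suc p) = pre p @ replicate (n p) 0 @ t p"
    by (auto simp: pre_def n_def)
  have t_ne: "t p \<noteq> []" for p using t[of p] by auto
  have s_pre: "s i = pre p ! i" if "i < a p" for i p
    unfolding s_def by (rule block_sequence_prefix[OF t_ne pre]) (use that in \<open>simp add: a_def\<close>)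
  have a_Suc: "a (Suc p) = a p + n p + length (t p)" for p by (simp add: a_def pre)
  have s_pre_Suc: "s i = (replicate (n p) 0 @ t p) ! (i - a p)" if "a p \<le> i" "i < a (Suc p)" for i p
    using s_pre[OF that(2)] that by (simp add: pre nth_append a_def)
  have tw: "length (takeWhile (\<lambda>x. x = 0) (t p)) < length (t p)" for p
  proof -
    have "0 < length (dropWhile (\<lambda>x. x = 0) (t p))" using t[of p] by (auto simp: dropWhile_eq_Nil_conv)
    moreover have "length (t p) = length (takeWhile (\<lambda>x. x = 0) (t p)) + length (dropWhile (\<lambda>x. x = 0) (t p))"
      by (simp flip: length_append)
    ultimately show ?thesis by linarith
  qed
  have ab: "a p \<le> b p" "b p < a (Suc p)" for p using tw[of p] by (auto simp: b_def a_Suc)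
  have zero: "s i = 0" if "a p \<le> i" "i < b p" for i p
  proof (cases "i - a p < n p")
    case True
    then show ?thesis using s_pre_Suc[of p i] that ab[of p] by (simp add: nth_append)
  next
    case False
    define j where "j = i - a p - n p"
    have j: "j < length (takeWhile (\<lambda>x. x = 0) (t p))" using that False by (simp add: j_def b_def)
    have "s i = t p ! j" using s_pre_Suc[of p i] that ab[of p] False by (simp add: nth_append j_def)
    also have "\<dots> = takeWhile (\<lambda>x. x = 0) (t p) ! j" using j by (simp add: takeWhile_nth)
    also have "\<dots> = 0" using nth_mem[OF j] by (auto dest: set_takeWhileD)
    finally show ?thesis .
  qed
  have s_b: "s (b p) \<noteq> 0" for p
  proof -
    have "s (b p) = t p ! length (takeWhile (\<lambda>x. x = 0) (t p))"
      using s_pre_Suc[of p "b p"] ab[of p] by (simp add: b_def nth_append)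
    then show ?thesis using nth_length_takeWhile[OF tw] by simp
  qed
  have s_J: "\<bar>s i\<bar> \<le> J p" if "b p \<le> i" "i < b (Suc p)" for i p
  proof (cases "i < a (Suc p)")
    case True
    have "s i = t p ! (i - a p - n p)" "i - a p - n p < length (t p)"
      using s_pre_Suc[of p i] that ab[of p] True by (auto simp: b_def nth_append a_Suc)
    then show ?thesis using J by simp
  next
    case False
    then show ?thesis using zero[of "Suc p" i] that J0 by simp
  qed
  have a_mono: "strict_mono a" by (intro strict_monoI_Suc) (use ab le_less_trans in blast)
  have a_ge: "m \<le> a m" for m using a_mono by (rule strict_mono_imp_increasing)
  have "\<forall>i<a p. \<bar>s i\<bar> \<le> int i" for p
  proof (induction p)
    case (Suc p)
    show ?case
    proof (intro allI impI)
      fix i assume i: "i < a (Suc p)"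
      consider "i < a p" | "a p \<le> i" "i < b p" | "b p \<le> i" by linarith
      then show "\<bar>s i\<bar> \<le> int i"
      proof cases
        case 3
        have "\<bar>s i\<bar> \<le> J p" using s_J[OF 3] i ab[of "Suc p"] by simp
        also have "\<dots> \<le> int (n p)" using N(3) by (simp add: n_def)
        also have "\<dots> \<le> int i" using 3 by (simp add: b_def)
        finally show ?thesis .
      qed (use Suc zero in auto)
    qed
  qed (simp add: a_def pre)
  then have slow: "\<bar>s i\<bar> \<le> int i" for i using a_ge[of "Suc i"] by (meson Suc_le_eq)
  have map_pre: "map s [0..<a p] = pre p" for p
    by (rule nth_equalityI) (auto simp: s_pre, simp add: a_def)
  have good: "good p (pre p) (b p - a p)" for p
    using N(1) by (simp add: b_def n_def)
  have "block_itinerary lam s q a b c d"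
  proof
    fix m
    show "\<bar>s m\<bar> \<le> int m" by (rule slow)
    show "\<exists>k\<ge>m. s k \<noteq> 0" using s_b[of m] a_ge[of m] ab(1)[of m] by (meson order_trans)
    show "\<exists>a\<ge>m. \<exists>N\<ge>a. 1 \<le> N \<and> (\<forall>i. a \<le> i \<and> i < a + N \<longrightarrow> s i = 0)"
      using a_ge[of m] N(2)[of "pre m" m] N(4)[of m "pre m"] zero[of m]
      by (intro exI[of _ "a m"] conjI exI[of _ "n m"]) (auto simp: a_def n_def b_def)
  next
    fix p i assume i: "b p \<le> i" "i < b (Suc p)"
    have "real_of_int \<bar>s i\<bar> \<le> real_of_int (J p)" using s_J[OF i] by (simp only: of_int_le_iff)
    then have "(2 * \<bar>real_of_int (s i)\<bar> + 1) * pi \<le> (2 * real_of_int (J p) + 1) * pi"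
      by (intro mult_right_mono) auto
    then show "real p + (2 * \<bar>real_of_int (s i)\<bar> + 1) * pi \<le> d p" using c_q_nonneg by (simp only: d_def)
  next
    fix p
    have "0 \<le> (2 * real_of_int (J p) + 1) * pi" using J0[of p] by simp
    then show "c_q \<le> d p" by (simp add: d_def)
  next
    fix p m z assume m: "b p \<le> m" "m \<le> b (Suc p)" and z: "z \<in> offaxis (d p)"
    \<comment> \<open>Splits the segment where \<open>t p\<close> ends. What follows belongs to the
      next zero run, whose length is chosen later; the radius \<open>c p\<close> is uniform in the
      number of those zeros.\<close>
    define k where "k = min m (a (Suc p))"
    have k: "b p \<le> k" "k \<le> m" "k \<le> a (Suc p)" using m ab[of p] by (auto simp: k_def)
    have "map s [b p..<m] = map s [b p..<k] @ map s [k..<m]"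
      using k by (metis le_add_diff_inverse map_append upt_add_eq_append)
    also have "map s [k..<m] = replicate (m - k) 0"
      using zero[of "Suc p"] m by (intro replicate_eqI) (auto simp: k_def min_def split: if_splits)
    finally have "map s [b p..<m] = map s [b p..<k] @ replicate (m - k) 0" .
    moreover have "pull lam (map s [b p..<k] @ replicate (m - k) 0) z \<in> offaxis (c p)"
    proof (rule c[OF z])
      show "length (map s [b p..<k]) \<le> length (t p)" using k by (simp add: b_def a_Suc)
      show "\<forall>x\<in>set (map s [b p..<k]). \<bar>x\<bar> \<le> J p" using s_J[of p] k ab[of "Suc p"] by auto
    qed
    ultimately show "pull lam (map s [b p..<m]) z \<in> offaxis (c p)" by simp
  qed (use ab zero s_b good in \<open>auto simp: good_def map_pre\<close>)
  then show ?thesis unfolding s_def by blast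
qed

end

section \<open>Exponential boundedness and the conclusion\<close>

lemma (in slow_itinerary) exponentially_bounded: "exponentially_bounded s"
proof -
  have F_eq: "(\<lambda>t. exp t - 1) = F" by (simp add: F_def fun_eq_iff)
  have "real_of_int \<bar>s k\<bar> < 1 * ((\<lambda>t. exp t - 1) ^^ k) 2" for k
    unfolding F_eq using slow_real[of k] F_iter_large[of 2 2 k] by simp
  then show ?thesis unfolding exponentially_bounded_def by (intro exI[of _ 1] conjI exI[of _ 2]) auto
qed

theorem theorem2:
  fixes lam :: real and t :: "nat \<Rightarrow> int list"
  assumes "lam > 1 / exp 1"
    and "\<And>m. \<exists>a\<in>set (t m). a \<noteq> 0"
  shows "\<exists>n :: nat \<Rightarrow> nat.
    let s = block_sequence n t;
        I = itinerary_set lam s;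
        \<gamma> = hair lam s;
        P = (\<lambda>zs. zs \<in> I \<and>
              (Some (q_plus lam) \<in> omega_limit lam zs \<or> Some (q_minus lam) \<in> omega_limit lam zs) \<and>
              (\<forall>z \<in> I - (\<gamma> \<union> {zs}). omega_limit lam z = Some ` Orb0 lam \<union> {None}))
    in exponentially_bounded s \<and>
       (\<exists>!zs. P zs) \<and>
       (\<forall>zs. P zs \<longrightarrow>
          (\<forall>z \<in> I. z \<noteq> zs \<and> z \<notin> I - (\<gamma> \<union> {zs}) \<longrightarrow>
             z \<in> \<gamma> \<and> omega_limit lam z = {None}))"
proof -
  interpret exp_map lam by unfold_locales (rule assms(1))
  obtain q where q: "E lam q = q" "0 < Im q" "Im q < pi" using upper_fixed_point_exists by blast
  interpret exp_map_fixed lam q by unfold_locales (use q in auto)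
  obtain n a b c d where "block_itinerary lam (block_sequence n t) q a b c d"
    using exists_block_itinerary[of t] assms(2) by blast
  define s where "s = block_sequence n t"
  interpret block_itinerary lam s q a b c d unfolding s_def by fact
  define P where "P = (\<lambda>zs. zs \<in> itinerary_set lam s \<and>
    (Some (q_plus lam) \<in> omega_limit lam zs \<or> Some (q_minus lam) \<in> omega_limit lam zs) \<and>
    (\<forall>z \<in> itinerary_set lam s - (hair lam s \<union> {zs}). omega_limit lam z = Some ` Orb0 lam \<union> {None}))"
  have hair_omega: "omega_limit lam z = {None}" if "z \<in> hair lam s" for z
    using that omega_limit_escaping by (simp add: hair_eq_escaping_set escaping_set_def)
  have q_notin: "q_plus lam \<notin> Orb0 lam" "q_minus lam \<notin> Orb0 lam"
    using Orb0_Im[of q] Orb0_Im[of "cnj q"] q(2) by (auto simp: q_plus_eq q_minus_eq)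
  have "\<exists>!zs. P zs"
  proof (rule ex_ex1I)
    show "\<exists>zs. P zs" using central_and_noncentral_points by (auto simp: P_def)
    fix zs zs' assume P: "P zs" "P zs'"
    show "zs = zs'"
    proof (rule ccontr)
      \<comment> \<open>By property (ii) of \<open>zs\<close>, the limit set of \<open>zs'\<close>
        is one of two sets whose finite points are all real, while \<open>P zs'\<close> demands a
        non-real one.\<close>
      assume "zs \<noteq> zs'"
      then have "omega_limit lam zs' = {None} \<or> omega_limit lam zs' = Some ` Orb0 lam \<union> {None}"
        using P hair_omega unfolding P_def by blast
      then show False using P(2) q_notin unfolding P_def by auto
    qed
  qed
  moreover have "\<forall>zs. P zs \<longrightarrow> (\<forall>z \<in> itinerary_set lam s. z \<noteq> zs \<and> z \<notin> itinerary_set lam s - (hair lam s \<union> {zs}) \<longrightarrow>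
      z \<in> hair lam s \<and> omega_limit lam z = {None})"
    using hair_omega by blast
  ultimately show ?thesis
    using exponentially_bounded unfolding Let_def s_def P_def
    by (intro exI[of _ n]) (intro conjI; assumption)
qed

end
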